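(* Suppose that for every $z\in\mathcal{Z}$ the map $\mathbf{w}\mapsto f(\mathbf{w};z)$ is nonnegative and convex. Let $\mathcal{W}=\mathbb{R}^d$, let $\mathcal{A}$ be Algorithm 1 (see context) with $T$ iterations producing iterates $\{\mathbf{w}_t\}$ and output $\mathbf{w}_{\mathrm{priv}}$, and let $\gamma>0$. (a) If $f$ is $L$-smooth and $\eta_t\le2/L$ for all $t\in[T]$, then $$\mathbb{E}_{S,\mathcal{A}}[F(\mathbf{w}_{\mathrm{priv}})-F_S(\mathbf{w}_{\mathrm{priv}})]\le\frac L\gamma\mathbb{E}_{S,\mathcal{A}}[F_S(\mathbf{w}_{\mathrm{priv}})]+\frac{4e(L+\gamma)(1+T/n)L}{n}\sum_{t=1}^T\eta_t^2\,\mathbb{E}_{S,\mathcal{A}}[F_S(\mathbf{w}_t)].$$ (b) If $f$ is $\alpha$-Hölder smooth with parameter $L$ and $\alpha\in[0,1)$, then $$\mathbb{E}_{S,\mathcal{A}}[F(\mathbf{w}_{\mathrm{priv}})-F_S(\mathbf{w}_{\mathrm{priv}})]\le\frac{c_{\alpha,1}^2}{2\gamma}\mathbb{E}_{S,\mathcal{A}}\big[F^{\frac{2\alpha}{1+\alpha}}(\mathbf{w}_{\mathrm{priv}})\big]+\frac\gamma2\Big(c_{\alpha,3}^2e\sum_{t=1}^T\eta_t^{\frac2{1-\alpha}}+\frac{4ec_{\alpha,1}^2(1+T/n)}{n}\sum_{t=1}^T\eta_t^2\,\mathbb{E}_{S,\mathcal{A}}\big[F_S^{\frac{2\alpha}{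1+\alpha}}(\mathbf{w}_t)\big]\Big).$$
   Context: $\rho$ is a probability measure on $\mathcal{Z}=\mathcal{X}\times\mathcal{Y}$, $\mathcal{X}\subset\mathbb{R}^d$, $\mathcal{Y}\subset\mathbb{R}$; $S=\{z_1,\dots,z_n\}$ i.i.d. from $\rho$. Loss $f:\mathbb{R}^d\times\mathcal{Z}\to\mathbb{R}$ with (sub)gradient $\partial f(\mathbf{w};z)$. $F(\mathbf{w})=\mathbb{E}_{z\sim\rho}[f(\mathbf{w};z)]$, $F_S(\mathbf{w})=\frac1n\sum_{i=1}^nf(\mathbf{w};z_i)$. $L$-smooth: $f(\mathbf{w};z)\le f(\mathbf{w}';z)+\langle\partial f(\mathbf{w}';z),\mathbf{w}-\mathbf{w}'\rangle+\frac L2\|\mathbf{w}-\mathbf{w}'\|_2^2$; $\alpha$-Hölder smooth with parameter $L$: $\|\partial f(\mathbf{w};z)-\partial f(\mathbf{w}';z)\|_2\le L\|\mathbf{w}-\mathbf{w}'\|_2^\alpha$. Constants: with $M=\sup_{z\in\mathcal{Z}}f(0;z)$, $c_{\alpha,1}=(1+1/\alpha)^{\frac{\alpha}{1+\alpha}}L^{\frac1{1+\alpha}}$ if $\alpha>0$ and $c_{0,1}=M+L$; $c_{\alpha,3}=\sqrt{\frac{1-\alpha}{1+\alpha}}(2^{-\alpha}L)^{\frac1{1-\alpha}}$. Algorithm 1: given $G>0$, $\epsilon>0$, $\delta\in(0,1)$, $\beta\in(0,1)$ and step sizes $\eta_t$, set $\mathbf{w}_1=\mathbf{0}$; for $t=1,\dots,T$,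 sample $i_t$ uniformly from $\{1,\dots,n\}$, draw $\mathbf{b}_t\sim\mathcal{N}(0,\sigma^2\mathbf{I}_d)$ with $\sigma^2=\frac{14G^2T}{\beta n^2\epsilon}\big(\frac{\log(1/\delta)}{(1-\beta)\epsilon}+1\big)$ (all independent), and set $\mathbf{w}_{t+1}=\mathbf{w}_t-\eta_t(\partial f(\mathbf{w}_t;z_{i_t})+\mathbf{b}_t)$ (projection onto $\mathcal{W}=\mathbb{R}^d$ is the identity). Output $\mathbf{w}_{\mathrm{priv}}=\frac1T\sum_{t=1}^T\mathbf{w}_t$. $\mathbb{E}_{S,\mathcal{A}}$ is expectation over the sample and the algorithm's randomness. *)

theory Defs
  imports "HOL-Probability.Probability"
begin

(* Nonnegative real power with the mathematical convention x^0 = 1 (also for x = 0). *)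
definition nnpow :: "real \<Rightarrow> real \<Rightarrow> real" where
  "nnpow x p = (if p = 0 then 1 else x powr p)"

definition l_smooth ::
  "real \<Rightarrow> ('w::real_inner \<Rightarrow> 'z \<Rightarrow> real) \<Rightarrow> ('w \<Rightarrow> 'z \<Rightarrow> 'w) \<Rightarrow> 'z set \<Rightarrow> bool" where
  "l_smooth L f g Z \<longleftrightarrow> (\<forall>z\<in>Z. \<forall>w w'.
      f w z \<le> f w' z + inner (g w' z) (w - w') + L / 2 * (norm (w - w'))\<^sup>2)"

definition holder_smooth ::
  "real \<Rightarrow> real \<Rightarrow> ('w::real_normed_vector \<Rightarrow> 'z \<Rightarrow> 'w) \<Rightarrow> 'z set \<Rightarrow> bool" where
  "holder_smooth \<alpha> L g Z \<longleftrightarrow> (\<forall>z\<in>Z. \<forall>w w'.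
      norm (g w z - g w' z) \<le> L * nnpow (norm (w - w')) \<alpha>)"

definition is_subgradient ::
  "('w::real_inner \<Rightarrow> 'z \<Rightarrow> real) \<Rightarrow> ('w \<Rightarrow> 'z \<Rightarrow> 'w) \<Rightarrow> 'z set \<Rightarrow> bool" where
  "is_subgradient f g Z \<longleftrightarrow> (\<forall>z\<in>Z. \<forall>w w'. f w' z \<ge> f w z + inner (g w z) (w' - w))"

definition gauss_vec :: "real \<Rightarrow> (real^'d) measure" where
  "gauss_vec s2 = distr (PiM UNIV (\<lambda>_::'d. density lborel (normal_density 0 (sqrt s2))))
                        borel (\<lambda>x. \<chi> i. x i)"

definition dp_sigma2 :: "real \<Rightarrow> real \<Rightarrow> real \<Rightarrow> real \<Rightarrow> nat \<Rightarrow> nat \<Rightarrow> real" where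
  "dp_sigma2 G \<epsilon> \<delta> \<beta> T n =
     14 * G\<^sup>2 * real T / (\<beta> * (real n)\<^sup>2 * \<epsilon>) * (ln (1 / \<delta>) / ((1 - \<beta>) * \<epsilon>) + 1)"

(* iterates w_t (t >= 1) of Algorithm 1 given sample S, indices I, noises B; w_1 = 0 *)
primrec dp_iter :: "('w::real_vector \<Rightarrow> 'z \<Rightarrow> 'w) \<Rightarrow> (nat \<Rightarrow> real) \<Rightarrow> (nat \<Rightarrow> 'z) \<Rightarrow>
    (nat \<Rightarrow> nat) \<Rightarrow> (nat \<Rightarrow> 'w) \<Rightarrow> nat \<Rightarrow> 'w" where
  "dp_iter g \<eta> S I B 0 = 0"
| "dp_iter g \<eta> S I B (Suc t) =
     (if t = 0 then 0
      else dp_iter g \<eta> S I B t - \<eta> t *\<^sub>R (g (dp_iter g \<eta> S I B t) (S (I t)) + B t))"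

(* joint randomness omega = (S, (I, B)): sample, sampled indices, Gaussian noises *)
definition alg_space :: "'z measure \<Rightarrow> nat \<Rightarrow> nat \<Rightarrow> real \<Rightarrow>
    ((nat \<Rightarrow> 'z) \<times> (nat \<Rightarrow> nat) \<times> (nat \<Rightarrow> real^'d)) measure" where
  "alg_space \<rho> n T s2 =
     PiM {..<n} (\<lambda>_. \<rho>) \<Otimes>\<^sub>M
       (PiM {1..T} (\<lambda>_. measure_pmf (pmf_of_set {..<n})) \<Otimes>\<^sub>M PiM {1..T} (\<lambda>_. gauss_vec s2))"

definition iterate_w :: "('w::real_vector \<Rightarrow> 'z \<Rightarrow> 'w) \<Rightarrow> (nat \<Rightarrow> real) \<Rightarrow>
    (nat \<Rightarrow> 'z) \<times> (nat \<Rightarrow> nat) \<times> (nat \<Rightarrow> 'w) \<Rightarrow> nat \<Rightarrow> 'w" where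
  "iterate_w g \<eta> \<omega> t = dp_iter g \<eta> (fst \<omega>) (fst (snd \<omega>)) (snd (snd \<omega>)) t"

definition w_priv :: "('w::real_vector \<Rightarrow> 'z \<Rightarrow> 'w) \<Rightarrow> (nat \<Rightarrow> real) \<Rightarrow> nat \<Rightarrow>
    (nat \<Rightarrow> 'z) \<times> (nat \<Rightarrow> nat) \<times> (nat \<Rightarrow> 'w) \<Rightarrow> 'w" where
  "w_priv g \<eta> T \<omega> = (1 / real T) *\<^sub>R (\<Sum>t=1..T. iterate_w g \<eta> \<omega> t)"

definition pop_risk :: "'z measure \<Rightarrow> ('w \<Rightarrow> 'z \<Rightarrow> real) \<Rightarrow> 'w \<Rightarrow> real" where
  "pop_risk \<rho> f w = (\<integral>z. f w z \<partial>\<rho>)"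

definition emp_risk :: "nat \<Rightarrow> ('w \<Rightarrow> 'z \<Rightarrow> real) \<Rightarrow> (nat \<Rightarrow> 'z) \<Rightarrow> 'w \<Rightarrow> real" where
  "emp_risk n f S w = (\<Sum>i<n. f w (S i)) / real n"

(* constants c_{alpha,1} (with M = sup_z f(0;z)) and c_{alpha,3} *)
definition c_a1 :: "real \<Rightarrow> real \<Rightarrow> real \<Rightarrow> real" where
  "c_a1 \<alpha> L M = (if \<alpha> > 0 then (1 + 1 / \<alpha>) powr (\<alpha> / (1 + \<alpha>)) * L powr (1 / (1 + \<alpha>))
                  else M + L)"

definition c_a3 :: "real \<Rightarrow> real \<Rightarrow> real" where
  "c_a3 \<alpha> L = sqrt ((1 - \<alpha>) / (1 + \<alpha>)) * (2 powr (- \<alpha>) * L) powr (1 / (1 - \<alpha>))"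

end

theory Submission
  imports Defs
begin

text \<open>Average replace-one stability. Exchanging the \<^term>\<open>i\<close>-th example with an independent ghost example
  preserves the joint law, so the expected gap between population and empirical risk is the average over
  \<^term>\<open>i\<close> of the change of the loss at the \<^term>\<open>i\<close>-th example under the exchange; smoothness (or convexity) and
  Young's inequality bound it by a squared gradient, controlled by the loss itself through self-bounding,
  plus the squared distance of the two outputs. The two runs share indices and noise, so the noise cancels: steps not using the
  \<^term>\<open>i\<close>-th example are (nearly) nonexpansive by co-coercivity, and the others occur with probability
  \<^term>\<open>1 / n\<close>, independently of the past.\<close>

text \<open>The two parts differ in where the loss is linearised. A smooth loss is expanded at the
  original output, so the gradient belongs to an example used in its training and self-bounding
  returns the empirical risk. Without a quadratic upper model the loss is linearised by convexity at
  the perturbed output instead; for that output the removed example is fresh, so the population risk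
  appears. The factor \<open>4 * exp 1 * (1 + T / n)\<close> has four sources: 2 from squaring a sum
  of two gradient norms, 2 from two losses with equal expectation, \<open>1 + T / n\<close> from the
  weight \<open>n / T\<close>, and \<open>exp 1\<close> from \<open>(1 + 1 / T) ^ T\<close>. Two
  obstacles shape the proof. Squared distances of the runs are not known to be integrable
  beforehand, so the recursion uses extended nonnegative integrals and integrability is read off
  from the final bound. And for \<alpha> < 1 cocoercivity controls a higher power of the gradient
  difference than the square; Young's inequality trades the deficit for an excess independent of the
  distance, which is the source of \<open>c_a3\<close>.\<close>

section \<open>Convex functions with Hoelder continuous subgradients\<close>

text \<open>A step from \<open>v\<close> against \<open>p\<close> lowers the upper model by its
  optimal amount and still cannot go below \<open>m\<close>. With \<open>m = 0\<close> this is
  self-bounding; with \<open>m\<close> the minimum of a tilted function it is half of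
  cocoercivity.\<close>

lemma gradient_bound_of_power_growth:
  fixes h :: "'a::real_inner \<Rightarrow> real"
  assumes lower: "\<And>x. m \<le> h x"
    and upper: "\<And>x. h x \<le> h v + inner p (x - v) + L / (1 + \<alpha>) * norm (x - v) powr (1 + \<alpha>)"
    and L: "L > 0" and \<alpha>: "\<alpha> > 0"
  shows "m + \<alpha> / (1 + \<alpha>) * ((norm p / L) powr (1 / \<alpha>) * norm p) \<le> h v"
proof (cases "p = 0")
  case True
  then show ?thesis using lower[of v] by simp
next
  case False
  \<comment> \<open>The step length minimising the upper bound along the direction of steepest descent.\<close>
  define r where "r = (norm p / L) powr (1 / \<alpha>)"
  have r: "r > 0" using False L by (simp add: r_def)
  define x where "x = v - (r / norm p) *\<^sub>R p"
  have nx: "norm (x - v) = r" using False r by (simp add: x_def)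
  have ip: "inner p (x - v) = - r * norm p"
    using False by (simp add: x_def power2_norm_eq_inner[symmetric] power2_eq_square)
  have "r powr (1 + \<alpha>) = r * r powr \<alpha>" using r by (simp add: powr_add)
  also have "r powr \<alpha> = norm p / L" using False L \<alpha> by (simp add: r_def powr_powr)
  finally have rp: "r powr (1 + \<alpha>) = r * (norm p / L)" .
  have "m \<le> h v - r * norm p + L / (1 + \<alpha>) * (r * (norm p / L))"
    using lower[of x] upper[of x] unfolding nx ip rp by simp
  also have "\<dots> = h v - \<alpha> / (1 + \<alpha>) * (r * norm p)"
    using L \<alpha> by (simp add: divide_simps) (simp add: algebra_simps)
  finally show ?thesis by (simp add: r_def)
qed

text \<open>Subtracting the linear function \<open>inner (g w)\<close> makes \<open>w\<close> a
  minimiser and leaves slope \<open>g v - g w\<close> at \<open>v\<close>, so the preceding bound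
  applies; adding the copy with \<open>v\<close> and \<open>w\<close> exchanged gives the claim. For
  \<alpha> = 1 this is the Baillon-Haddad inequality with constant \<open>1 / L\<close>.\<close>

lemma cocoercive_of_power_growth:
  fixes f :: "'a::real_inner \<Rightarrow> real"
  assumes sub: "\<And>w w'. f w + inner (g w) (w' - w) \<le> f w'"
    and upper: "\<And>w w'. f w' \<le> f w + inner (g w) (w' - w) + L / (1 + \<alpha>) * norm (w' - w) powr (1 + \<alpha>)"
    and L: "L > 0" and \<alpha>: "\<alpha> > 0"
  shows "2 * \<alpha> / (1 + \<alpha>) * ((norm (g v - g w) / L) powr (1 / \<alpha>) * norm (g v - g w))
         \<le> inner (g v - g w) (v - w)"
proof -
  have half: "f w - inner (g w) w + \<alpha> / (1 + \<alpha>) * ((norm (g v - g w) / L) powr (1 / \<alpha>) * norm (g v - g w))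
      \<le> f v - inner (g w) v" for v w
  proof (rule gradient_bound_of_power_growth[OF _ _ L \<alpha>])
    show "f w - inner (g w) w \<le> f x - inner (g w) x" for x
      using sub[of w x] by (simp add: inner_diff_right)
    show "f x - inner (g w) x \<le> f v - inner (g w) v + inner (g v - g w) (x - v)
            + L / (1 + \<alpha>) * norm (x - v) powr (1 + \<alpha>)" for x
      using upper[of x v] by (simp add: inner_diff_right inner_diff_left)
  qed
  from half[of w v] half[of v w] show ?thesis
    by (simp add: inner_diff_left inner_diff_right norm_minus_commute)
qed

text \<open>The Hoelder bound is integrated along the segment from \<open>w\<close> to
  \<open>w'\<close>; \<open>1 / (1 + \<alpha>)\<close> is the integral of
  \<open>s powr \<alpha>\<close> over the unit interval. As \<open>g\<close> is merely a selection
  of subgradients, differentiability along the segment has to be derived first, and \<alpha> > 0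
  gives it.\<close>

lemma holder_gradient_power_growth:
  fixes f :: "'a::real_inner \<Rightarrow> real"
  assumes sub: "\<And>w w'. f w + inner (g w) (w' - w) \<le> f w'"
    and holder: "\<And>w w'. norm (g w - g w') \<le> L * norm (w - w') powr \<alpha>"
    and L: "L \<ge> 0" and \<alpha>: "\<alpha> > 0"
  shows "f w' \<le> f w + inner (g w) (w' - w) + L / (1 + \<alpha>) * norm (w' - w) powr (1 + \<alpha>)"
proof (cases "w' = w")
  case False
  define d where "d = w' - w"
  define N where "N = norm d"
  have N: "N > 0" using False by (simp add: N_def d_def)
  define \<phi> where "\<phi> s = f (w + s *\<^sub>R d)" for s :: real
  define \<psi> where "\<psi> s = inner (g (w + s *\<^sub>R d)) d" for s :: real
  have \<psi>: "\<bar>\<psi> s - \<psi> t\<bar> \<le> L * N powr (1 + \<alpha>) * \<bar>s - t\<bar> powr \<alpha>" for s t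
  proof -
    have "\<bar>\<psi> s - \<psi> t\<bar> = \<bar>inner (g (w + s *\<^sub>R d) - g (w + t *\<^sub>R d)) d\<bar>"
      by (simp add: \<psi>_def inner_diff_left)
    also have "\<dots> \<le> norm (g (w + s *\<^sub>R d) - g (w + t *\<^sub>R d)) * N"
      unfolding N_def by (rule Cauchy_Schwarz_ineq2)
    also have "\<dots> \<le> (L * norm ((s - t) *\<^sub>R d) powr \<alpha>) * N"
      using holder[of "w + s *\<^sub>R d" "w + t *\<^sub>R d"] N
      by (intro mult_right_mono) (auto simp: algebra_simps)
    also have "\<dots> = L * N powr (1 + \<alpha>) * \<bar>s - t\<bar> powr \<alpha>"
      using N by (simp add: N_def powr_mult powr_add)
    finally show ?thesis .
  qed
  have step: "\<phi> s + (t - s) * \<psi> s \<le> \<phi> t" for s t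
    using sub[of "w + s *\<^sub>R d" "w + t *\<^sub>R d"]
    by (simp add: \<phi>_def \<psi>_def inner_scaleR_right[symmetric] algebra_simps
        del: inner_scaleR_right)
  define C where "C = L * N powr (1 + \<alpha>)"
  have C: "C \<ge> 0" using L by (simp add: C_def)
  \<comment> \<open>The subgradient inequalities at both ends squeeze the difference quotient.\<close>
  have deriv: "(\<phi> has_real_derivative \<psi> s) (at s)" for s
    unfolding has_field_derivative_def
  proof (rule has_derivativeI)
    show "bounded_linear ((*) (\<psi> s))" by (rule bounded_linear_mult_right)
    have *: "norm ((\<phi> y - \<phi> s - \<psi> s * (y - s)) /\<^sub>R norm (y - s)) \<le> C * \<bar>y - s\<bar> powr \<alpha>" for y
    proof (cases "y = s")
      case False
      have "0 \<le> \<phi> y - \<phi> s - \<psi> s * (y - s)" using step[of s y] by (simp add: algebra_simps)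
      moreover have "\<phi> y - \<phi> s - \<psi> s * (y - s) \<le> (\<psi> y - \<psi> s) * (y - s)"
        using step[of y s] by (simp add: algebra_simps)
      moreover have "(\<psi> y - \<psi> s) * (y - s) \<le> \<bar>\<psi> y - \<psi> s\<bar> * \<bar>y - s\<bar>"
        by (metis abs_ge_self abs_mult)
      moreover have "\<dots> \<le> (C * \<bar>y - s\<bar> powr \<alpha>) * \<bar>y - s\<bar>"
        using \<psi>[of y s] by (intro mult_right_mono) (auto simp: C_def)
      ultimately have "\<bar>\<phi> y - \<phi> s - \<psi> s * (y - s)\<bar> \<le> (C * \<bar>y - s\<bar> powr \<alpha>) * \<bar>y - s\<bar>"
        by linarith
      then show ?thesis using False
        by (simp add: field_simps abs_mult)
    qed simp
    have lim: "((\<lambda>y. C * \<bar>y - s\<bar> powr \<alpha>) \<longlongrightarrow> C * \<bar>s - s\<bar> powr \<alpha>) (at s)"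
      using \<alpha> by (intro tendsto_intros) auto
    show "((\<lambda>y. (\<phi> y - \<phi> s - \<psi> s * (y - s)) /\<^sub>R norm (y - s)) \<longlongrightarrow> 0) (at s)"
      by (rule Lim_null_comparison[OF always_eventually]) (use * lim \<alpha> in auto)
  qed
  \<comment> \<open>Restriction of \<open>f\<close> to the line minus the claimed increment:
    \<open>\<theta> 0\<close> is \<open>f w\<close>, and \<open>\<theta> 1 \<le> \<theta> 0\<close>
    is the claim. The open-interval criterion avoids differentiating \<open>powr\<close> at
    0.\<close>
  define \<theta> where "\<theta> s = \<phi> s - s * \<psi> 0 - C / (1 + \<alpha>) * s powr (1 + \<alpha>)" for s :: real
  have cont_\<phi>: "continuous_on A \<phi>" for A
    by (metis DERIV_continuous_on deriv DERIV_subset top_greatest)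
  have "\<theta> 0 \<ge> \<theta> 1"
  proof (rule DERIV_nonpos_imp_decreasing_open[of 0 1 \<theta>])
    show "continuous_on {0..1} \<theta>"
      unfolding \<theta>_def using \<alpha> by (intro continuous_intros cont_\<phi> continuous_on_powr') auto
    fix x :: real assume x: "0 < x" "x < 1"
    have "((\<lambda>s. s powr (1 + \<alpha>)) has_real_derivative ((1 + \<alpha>) * x powr \<alpha>)) (at x)"
      using has_real_derivative_powr[OF x(1), of "1 + \<alpha>"] by simp
    then have "(\<theta> has_real_derivative \<psi> x - \<psi> 0 - C / (1 + \<alpha>) * ((1 + \<alpha>) * x powr \<alpha>)) (at x)"
      unfolding \<theta>_def by (intro DERIV_diff DERIV_cmult deriv) (auto intro!: derivative_eq_intros)
    moreover have "\<psi> x - \<psi> 0 - C / (1 + \<alpha>) * ((1 + \<alpha>) * x powr \<alpha>) \<le> 0"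
      using \<psi>[of x 0] x \<alpha> by (simp add: C_def)
    ultimately show "\<exists>y. (\<theta> has_real_derivative y) (at x) \<and> y \<le> 0" by blast
  qed simp
  then show ?thesis
    using \<alpha> by (simp add: \<theta>_def \<phi>_def \<psi>_def C_def N_def d_def)
qed simp

text \<open>Nonnegativity forces the slopes along a descending ray to tend to a nonnegative limit, so the
  oscillation of the gradient already bounds its size.\<close>

lemma gradient_bound_of_oscillation:
  fixes f :: "'a::real_inner \<Rightarrow> real"
  assumes sub: "\<And>w w'. f w + inner (g w) (w' - w) \<le> f w'"
    and nonneg: "\<And>w. 0 \<le> f w"
    and osc: "\<And>w w'. norm (g w - g w') \<le> C"
  shows "norm (g w) \<le> C"
proof (rule field_le_epsilon)
  fix e :: real assume e: "e > 0"
  show "norm (g w) \<le> C + e"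
  proof (cases "g w = 0")
    case True
    then show ?thesis using e order_trans[OF norm_ge_zero osc[of w w]] by simp
  next
    case False
    define u where "u = g w /\<^sub>R norm (g w)"
    \<comment> \<open>A descent of length \<open>s\<close> leaves a slope of at most
      \<open>f w / s\<close>; this \<open>s\<close> makes it at most \<open>e\<close>, and the added
      1 keeps \<open>s\<close> positive even if \<open>f w = 0\<close>.\<close>
    define s where "s = (f w + 1) / e"
    have s: "s > 0" using e nonneg[of w] by (simp add: s_def)
    have u: "norm u = 1" using False by (simp add: u_def)
    define x where "x = w - s *\<^sub>R u"
    have "s * inner (g x) u \<le> f w"
      using sub[of x w] nonneg[of x] by (simp add: x_def)
    also have "f w \<le> s * e" using e by (simp add: s_def)
    finally have "inner (g x) u \<le> e" using s by simp
    moreover have "inner (g w - g x) u \<le> C"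
      using norm_cauchy_schwarz[of "g w - g x" u] osc[of w x] u by simp
    moreover have "norm (g w) = inner (g w) u"
      using False by (simp add: u_def power2_norm_eq_inner[symmetric] power2_eq_square)
    ultimately show ?thesis by (simp add: inner_diff_left)
  qed
qed

text \<open>In HOL \<open>0 powr \<theta>\<close> is 0 even for \<theta> = 0, so the left side
  vanishes whenever an argument does; positive arguments are the usual Young inequality.\<close>

lemma weighted_am_gm:
  fixes a b \<theta> :: real
  assumes "0 \<le> \<theta>" "\<theta> \<le> 1" "0 \<le> a" "0 \<le> b"
  shows "a powr \<theta> * b powr (1 - \<theta>) \<le> \<theta> * a + (1 - \<theta>) * b"
  using assms Youngs_inequality_0[of \<theta> "1 - \<theta>" a b]
  by (cases "a = 0 \<or> b = 0") auto

lemma norm_gradient_step: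
  fixes x y u v :: "'a::real_inner"
  shows "(norm ((x - \<eta> *\<^sub>R u) - (y - \<eta> *\<^sub>R v)))\<^sup>2
    = (norm (x - y))\<^sup>2 - 2 * \<eta> * inner (u - v) (x - y) + \<eta>\<^sup>2 * (norm (u - v))\<^sup>2"
  unfolding power2_norm_eq_inner
  by (simp add: inner_diff_left inner_diff_right inner_commute power2_eq_square algebra_simps)

text \<open>In the expanded square, cocoercivity makes the cross term at least
  \<open>2 * \<eta> / L\<close> times the squared gradient difference, which outweighs the factor
  \<open>\<eta>\<^sup>2\<close> of the last term as soon as
  \<open>\<eta> \<le> 2 / L\<close>.\<close>

lemma smooth_gradient_step_nonexpansive:
  fixes f :: "'a::real_inner \<Rightarrow> real"
  assumes sub: "\<And>w w'. f w + inner (g w) (w' - w) \<le> f w'"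
    and smooth: "\<And>w w'. f w' \<le> f w + inner (g w) (w' - w) + L / 2 * (norm (w' - w))\<^sup>2"
    and L: "L > 0" and \<eta>: "0 \<le> \<eta>" "\<eta> \<le> 2 / L"
  shows "(norm ((v - \<eta> *\<^sub>R g v) - (w - \<eta> *\<^sub>R g w)))\<^sup>2 \<le> (norm (v - w))\<^sup>2"
proof -
  have "(norm (g v - g w))\<^sup>2 / L \<le> inner (g v - g w) (v - w)"
    using cocoercive_of_power_growth[of f g L 1, OF sub _ L, of v w] smooth L
    by (simp add: power2_eq_square)
  then have "2 * \<eta> * ((norm (g v - g w))\<^sup>2 / L) \<le> 2 * \<eta> * inner (g v - g w) (v - w)"
    using \<eta> by (intro mult_left_mono) auto
  moreover have "\<eta>\<^sup>2 * (norm (g v - g w))\<^sup>2 \<le> 2 * \<eta> * ((norm (g v - g w))\<^sup>2 / L)"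
    using mult_left_mono[OF \<eta>(2), of "\<eta> * (norm (g v - g w))\<^sup>2"] \<eta>
    by (simp add: power2_eq_square algebra_simps)
  ultimately show ?thesis unfolding norm_gradient_step by linarith
qed

lemma smooth_self_bounding:
  fixes f :: "'a::real_inner \<Rightarrow> real"
  assumes smooth: "\<And>w w'. f w' \<le> f w + inner (g w) (w' - w) + L / 2 * (norm (w' - w))\<^sup>2"
    and nonneg: "\<And>w. 0 \<le> f w" and L: "L > 0"
  shows "(norm (g w))\<^sup>2 \<le> 2 * L * f w"
  using gradient_bound_of_power_growth[of 0 f w "g w" L 1] smooth nonneg L
  by (simp add: power2_eq_square field_simps)

text \<open>Cocoercivity only dominates the power \<open>1 + 1 / \<alpha>\<close> of the gradient
  difference, which is too weak for small differences. Weighted AM-GM writes the quadratic term as a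
  part absorbed by the cross term plus a part depending on \<eta> alone.\<close>

lemma holder_gradient_step:
  fixes f :: "'a::real_inner \<Rightarrow> real"
  assumes sub: "\<And>w w'. f w + inner (g w) (w' - w) \<le> f w'"
    and holder: "\<And>w w'. norm (g w - g w') \<le> L * nnpow (norm (w - w')) \<alpha>"
    and L: "L \<ge> 0" and \<alpha>: "0 \<le> \<alpha>" "\<alpha> < 1" and \<eta>: "0 < \<eta>"
  shows "(norm ((v - \<eta> *\<^sub>R g v) - (w - \<eta> *\<^sub>R g w)))\<^sup>2
    \<le> (norm (v - w))\<^sup>2 + (c_a3 \<alpha> L)\<^sup>2 * \<eta> powr (2 / (1 - \<alpha>))"
proof -
  define D where "D = norm (g v - g w)"
  have D0: "D \<ge> 0" by (simp add: D_def)
  have mono: "0 \<le> inner (g v - g w) (v - w)"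
    using sub[of v w] sub[of w v] by (simp add: inner_diff_left inner_diff_right)
  have "\<eta>\<^sup>2 * D\<^sup>2 \<le> 2 * \<eta> * inner (g v - g w) (v - w) + (c_a3 \<alpha> L)\<^sup>2 * \<eta> powr (2 / (1 - \<alpha>))"
  proof -
    \<comment> \<open>The cocoercivity bound is stated for L > 0 and \<alpha> > 0. For \<alpha> = 0
      monotonicity of the subgradients and \<open>D \<le> L\<close> suffice, since
      \<open>c_a3 0 L = L\<close> for L > 0.\<close>
    consider "L = 0" | "L > 0" "\<alpha> = 0" | "L > 0" "\<alpha> > 0" using L \<alpha> by linarith
    then show ?thesis
    proof cases
      case 1
      then have "D = 0" using holder[of v w] by (simp add: D_def)
      then show ?thesis using mono \<eta> by simp
    next
      case 2
      have "\<eta>\<^sup>2 * D\<^sup>2 \<le> \<eta>\<^sup>2 * L\<^sup>2"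
        using holder[of v w] 2 D0 by (intro mult_left_mono power_mono) (auto simp: D_def nnpow_def)
      also have "\<dots> = (c_a3 \<alpha> L)\<^sup>2 * \<eta> powr (2 / (1 - \<alpha>))"
        using 2 \<eta> by (simp add: c_a3_def powr_numeral)
      finally show ?thesis using mono \<eta> by (smt (verit) mult_nonneg_nonneg)
    next
      case 3
      define \<theta> where "\<theta> = 2 * \<alpha> / (1 + \<alpha>)"
      have \<theta>: "0 \<le> \<theta>" "\<theta> \<le> 1" "1 - \<theta> = (1 - \<alpha>) / (1 + \<alpha>)"
        using \<alpha> by (auto simp: \<theta>_def field_simps)
      \<comment> \<open>The weight \<theta> is chosen so that \<open>A powr \<theta>\<close> is
        quadratic in \<open>D\<close>; \<open>B\<close> supplies the missing powers of 2,
        \<open>L\<close> and \<eta>. Then \<open>\<theta> * A\<close> is absorbed by the cross term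
        and \<open>(1 - \<theta>) * B\<close> is the excess.\<close>
      define A where "A = 2 * \<eta> * ((D / L) powr (1 / \<alpha>) * D)"
      define B where "B = (2 powr (- \<alpha>) * L * \<eta>) powr (2 / (1 - \<alpha>))"
      have coc: "\<theta> * ((D / L) powr (1 / \<alpha>) * D) \<le> inner (g v - g w) (v - w)"
        unfolding D_def \<theta>_def
        by (rule cocoercive_of_power_growth[of f g, OF sub _ 3])
          (rule holder_gradient_power_growth[of f g, OF sub _ L 3(2)],
            use holder 3 in \<open>auto simp: nnpow_def\<close>)
      have "\<eta>\<^sup>2 * D\<^sup>2 = A powr \<theta> * B powr (1 - \<theta>)"
      proof (cases "D = 0")
        case False
        then have D: "D > 0" using D0 by simp
        have "B powr (1 - \<theta>) = (2 powr (- \<alpha>) * L * \<eta>) powr (2 / (1 + \<alpha>))"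
          using \<alpha> nonzero_mult_divide_mult_cancel_left[of "1 - \<alpha>" 2 "1 + \<alpha>"]
          by (simp add: B_def \<theta>(3) powr_powr mult.commute)
        \<comment> \<open>Everything is positive here, so comparing logarithms turns the bookkeeping
          of exponents into a linear identity.\<close>
        then have "ln (A powr \<theta> * B powr (1 - \<theta>)) =
            \<theta> * (ln 2 + ln \<eta> + ((ln D - ln L) / \<alpha> + ln D)) + 2 / (1 + \<alpha>) * (- \<alpha> * ln 2 + ln L + ln \<eta>)"
          using D 3 \<eta> by (simp add: A_def ln_mult ln_powr ln_div)
        also have "\<dots> = 2 * ln \<eta> + 2 * ln D"
          using 3 by (simp add: \<theta>_def divide_simps) (simp add: algebra_simps)
        also have "\<dots> = ln (\<eta>\<^sup>2 * D\<^sup>2)"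
          using D \<eta> by (simp add: ln_mult ln_realpow)
        finally show ?thesis
          using D 3 \<eta> by (subst (asm) ln_inj_iff) (auto simp: A_def B_def)
      qed (simp add: A_def)
      also have "\<dots> \<le> \<theta> * A + (1 - \<theta>) * B"
        using \<theta> 3 D0 \<eta> by (intro weighted_am_gm) (auto simp: A_def B_def)
      also have "\<theta> * A \<le> 2 * \<eta> * inner (g v - g w) (v - w)"
        using mult_left_mono[OF coc, of "2 * \<eta>"] \<eta> by (simp add: A_def algebra_simps)
      also have "(1 - \<theta>) * B = (c_a3 \<alpha> L)\<^sup>2 * \<eta> powr (2 / (1 - \<alpha>))"
      proof -
        have "((2 powr (- \<alpha>) * L) powr (1 / (1 - \<alpha>)))\<^sup>2 = (2 powr (- \<alpha>) * L) powr (2 / (1 - \<alpha>))"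
          using 3 by (simp add: power2_eq_square powr_add[symmetric])
        then show ?thesis
          using \<alpha> 3 \<eta> by (simp add: \<theta>(3) c_a3_def power_mult_distrib B_def powr_mult)
      qed
      finally show ?thesis by simp
    qed
  qed
  then show ?thesis unfolding norm_gradient_step by (simp add: D_def)
qed

text \<open>For \<alpha> > 0 descending from \<open>w\<close> bounds a multiple of
  \<open>norm (g w) powr (1 + 1 / \<alpha>)\<close> by \<open>f w\<close>; raising to the power
  \<open>2 * \<alpha> / (1 + \<alpha>)\<close> produces the square, and \<open>c_a1\<close> collects
  the constants. For \<alpha> = 0 the gradient oscillates by at most \<open>L\<close>, so its norm
  is at most \<open>L\<close> and hence at most \<open>M + L\<close>, which is where
  \<open>M\<close> has to be nonnegative.\<close>

lemma holder_self_bounding: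
  fixes f :: "'a::real_inner \<Rightarrow> real"
  assumes sub: "\<And>w w'. f w + inner (g w) (w' - w) \<le> f w'"
    and holder: "\<And>w w'. norm (g w - g w') \<le> L * nnpow (norm (w - w')) \<alpha>"
    and nonneg: "\<And>w. 0 \<le> f w"
    and L: "L \<ge> 0" and \<alpha>: "0 \<le> \<alpha>" and M: "\<alpha> = 0 \<Longrightarrow> 0 \<le> M"
  shows "(norm (g w))\<^sup>2 \<le> (c_a1 \<alpha> L M)\<^sup>2 * nnpow (f w) (2 * \<alpha> / (1 + \<alpha>))"
proof -
  consider "L = 0" | "\<alpha> = 0" | "L > 0" "\<alpha> > 0" using L \<alpha> by linarith
  then show ?thesis
  proof cases
    case 1
    then have "norm (g w) \<le> 0"
      using holder by (intro gradient_bound_of_oscillation[OF sub nonneg]) simp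
    then show ?thesis by (simp add: nnpow_def)
  next
    case 2
    then have "norm (g w) \<le> L"
      using holder by (intro gradient_bound_of_oscillation[OF sub nonneg]) (simp add: nnpow_def)
    also have "L \<le> c_a1 \<alpha> L M" using 2 M by (simp add: c_a1_def)
    finally show ?thesis using 2 by (simp add: nnpow_def power_mono)
  next
    case 3
    have "0 + \<alpha> / (1 + \<alpha>) * ((norm (g w) / L) powr (1 / \<alpha>) * norm (g w)) \<le> f w"
      by (rule gradient_bound_of_power_growth[OF nonneg _ 3])
        (rule holder_gradient_power_growth[of f g, OF sub _ L 3(2)],
          use holder 3 in \<open>auto simp: nnpow_def\<close>)
    then have "(norm (g w) / L) powr (1 / \<alpha>) * norm (g w) \<le> (1 + 1 / \<alpha>) * f w"
      using 3 by (simp add: field_simps)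
    then have "((norm (g w) / L) powr (1 / \<alpha>) * norm (g w)) powr (2 * \<alpha> / (1 + \<alpha>))
        \<le> ((1 + 1 / \<alpha>) * f w) powr (2 * \<alpha> / (1 + \<alpha>))"
      using 3 by (intro powr_mono2) auto
    also have "((norm (g w) / L) powr (1 / \<alpha>) * norm (g w)) powr (2 * \<alpha> / (1 + \<alpha>))
        = (norm (g w))\<^sup>2 / L powr (2 / (1 + \<alpha>))"
    proof (cases "g w = 0")
      case False
      have "ln (((norm (g w) / L) powr (1 / \<alpha>) * norm (g w)) powr (2 * \<alpha> / (1 + \<alpha>)))
          = 2 * \<alpha> / (1 + \<alpha>) * ((ln (norm (g w)) - ln L) / \<alpha> + ln (norm (g w)))"
        using False 3 by (simp add: ln_mult ln_powr ln_div)
      also have "\<dots> = 2 * ln (norm (g w)) - 2 / (1 + \<alpha>) * ln L"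
        using 3 by (simp add: divide_simps) (simp add: algebra_simps)
      also have "\<dots> = ln ((norm (g w))\<^sup>2 / L powr (2 / (1 + \<alpha>)))"
        using False 3 by (simp add: ln_div ln_realpow ln_powr)
      finally show ?thesis
        using False 3 by (subst (asm) ln_inj_iff) auto
    qed simp
    also have "((1 + 1 / \<alpha>) * f w) powr (2 * \<alpha> / (1 + \<alpha>))
        = (1 + 1 / \<alpha>) powr (2 * \<alpha> / (1 + \<alpha>)) * f w powr (2 * \<alpha> / (1 + \<alpha>))"
      using 3 nonneg by (simp add: powr_mult)
    finally have "(norm (g w))\<^sup>2 \<le> ((1 + 1 / \<alpha>) powr (2 * \<alpha> / (1 + \<alpha>)) * L powr (2 / (1 + \<alpha>)))
        * f w powr (2 * \<alpha> / (1 + \<alpha>))"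
      using 3 by (simp add: field_simps)
    also have "(1 + 1 / \<alpha>) powr (2 * \<alpha> / (1 + \<alpha>)) * L powr (2 / (1 + \<alpha>)) = (c_a1 \<alpha> L M)\<^sup>2"
    proof -
      have "1 + 1 / \<alpha> \<noteq> 0" using 3 by (simp add: add_nonneg_eq_0_iff)
      then show ?thesis using 3 by (simp add: c_a1_def power_mult_distrib powr_power)
    qed
    finally show ?thesis using 3 by (simp add: nnpow_def)
  qed
qed

section \<open>Jensen's inequality for powers\<close>

lemma nnpow_nonneg [simp]: "0 \<le> nnpow x p"
  by (simp add: nnpow_def)

text \<open>This domination is what makes fractional powers of integrable nonnegative functions
  integrable on a finite measure space.\<close>

lemma nnpow_le_one_plus:
  assumes "0 \<le> x" "0 \<le> q" "q \<le> 1"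
  shows "nnpow x q \<le> 1 + x"
proof -
  have "x powr q \<le> 1 + x"
    using weighted_am_gm[of q x 1] assms mult_right_mono[of q 1 x] by simp
  then show ?thesis using assms by (simp add: nnpow_def)
qed

lemma borel_measurable_nnpow [measurable]:
  "f \<in> borel_measurable M \<Longrightarrow> (\<lambda>x. nnpow (f x) p) \<in> borel_measurable M"
  unfolding nnpow_def by (cases "p = 0") simp_all

lemma integrable_nnpow:
  assumes "finite_measure M" "integrable M f" "AE x in M. 0 \<le> f x" "0 \<le> q" "q \<le> 1"
  shows "integrable M (\<lambda>x. nnpow (f x) q)"
proof (rule Bochner_Integration.integrable_bound)
  interpret finite_measure M by fact
  show "integrable M (\<lambda>x. 1 + f x)" using assms by simp
  show "(\<lambda>x. nnpow (f x) q) \<in> borel_measurable M"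
    using assms by measurable
  show "AE x in M. norm (nnpow (f x) q) \<le> norm (1 + f x)"
    using assms(3) by eventually_elim (use nnpow_le_one_plus[OF _ assms(4,5)] in simp)
qed

text \<open>The power lies below its tangent at the mean \<open>m\<close>, which weighted AM-GM
  provides without differentiation; integrating the tangent gives the claim. The tangent is written
  with \<open>q / m\<close>, so \<open>m = 0\<close> is separate: there \<open>f\<close> vanishes
  almost everywhere. At \<open>q = 0\<close> both sides are 1 by the convention of
  \<open>nnpow\<close>.\<close>

lemma (in prob_space) jensen_nnpow:
  assumes f: "integrable M f" "AE x in M. 0 \<le> f x" and q: "0 \<le> q" "q \<le> 1"
  shows "(\<integral>x. nnpow (f x) q \<partial>M) \<le> nnpow (\<integral>x. f x \<partial>M) q"
proof (cases "q = 0")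
  case True
  then show ?thesis by (simp add: nnpow_def prob_space)
next
  case False
  define m where "m = (\<integral>x. f x \<partial>M)"
  have "0 \<le> m" unfolding m_def using f(2) by (rule integral_nonneg_AE)
  then consider "m = 0" | "m > 0" by linarith
  then show ?thesis
  proof cases
    case 1
    then have "AE x in M. f x = 0"
      using integral_nonneg_eq_0_iff_AE[OF f] by (simp add: m_def)
    then have "AE x in M. nnpow (f x) q = 0"
      by eventually_elim (use False in \<open>simp add: nnpow_def\<close>)
    then have "(\<integral>x. nnpow (f x) q \<partial>M) = 0" by (rule integral_eq_zero_AE)
    then show ?thesis by simp
  next
    case 2
    have tangent: "nnpow x q \<le> m powr q * (q / m * x + (1 - q))" if "0 \<le> x" for x
    proof -
      have "x powr q = m powr q * (x / m) powr q"
        using 2 that by (simp add: powr_divide)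
      also have "(x / m) powr q \<le> q / m * x + (1 - q)"
        using weighted_am_gm[of q "x / m" 1] q that 2 by simp
      finally show ?thesis using False by (simp add: nnpow_def mult_left_mono)
    qed
    have "(\<integral>x. nnpow (f x) q \<partial>M) \<le> (\<integral>x. m powr q * (q / m * f x + (1 - q)) \<partial>M)"
    proof (rule integral_mono_AE)
      show "integrable M (\<lambda>x. nnpow (f x) q)"
        using f q by (intro integrable_nnpow) unfold_locales
      show "AE x in M. nnpow (f x) q \<le> m powr q * (q / m * f x + (1 - q))"
        using f(2) by eventually_elim (rule tangent)
    qed (use f in simp)
    also have "\<dots> = m powr q * (q / m * m + (1 - q))"
      using f by (simp add: m_def prob_space)
    also have "\<dots> = nnpow m q" using 2 False by (simp add: nnpow_def)
    finally show ?thesis by (simp add: m_def)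
  qed
qed

text \<open>An arithmetic mean is an expectation under the uniform distribution on
  \<open>{..<n}\<close>, so the preceding inequality covers finite averages.\<close>

lemma mean_nnpow_le:
  fixes n :: nat
  assumes "n \<ge> 1" "\<And>i. i < n \<Longrightarrow> 0 \<le> x i" "0 \<le> q" "q \<le> 1"
  shows "(\<Sum>i<n. nnpow (x i) q) / real n \<le> nnpow ((\<Sum>i<n. x i) / real n) q"
proof -
  have ne: "{..<n} \<noteq> {}" using assms(1) by (simp add: lessThan_empty_iff)
  have "(\<integral>i. nnpow (x i) q \<partial>measure_pmf (pmf_of_set {..<n}))
      \<le> nnpow (\<integral>i. x i \<partial>measure_pmf (pmf_of_set {..<n})) q"
    using assms ne
    by (intro measure_pmf.jensen_nnpow integrable_measure_pmf_finite AE_pmfI)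
       (simp_all add: set_pmf_of_set)
  then show ?thesis using ne by (simp add: integral_pmf_of_set)
qed

section \<open>Exchanging and integrating out coordinates of a product measure\<close>

text \<open>Once coordinate \<open>i\<close> is integrated separately, \<open>S i\<close> and
  \<open>z\<close> are two independent draws from \<open>\<rho>\<close>; the exchange renames them,
  and Fubini swaps the order of integration.\<close>

lemma nn_integral_PiM_swap:
  assumes \<rho>: "prob_space \<rho>" and I: "finite I" "i \<in> I"
    and k [measurable]: "case_prod k \<in> borel_measurable (PiM I (\<lambda>_. \<rho>) \<Otimes>\<^sub>M \<rho>)"
  shows "(\<integral>\<^sup>+S. \<integral>\<^sup>+z. k (S(i := z)) (S i) \<partial>\<rho> \<partial>PiM I (\<lambda>_. \<rho>)) = (\<integral>\<^sup>+S. \<integral>\<^sup>+z. k S z \<partial>\<rho> \<partial>PiM I (\<lambda>_. \<rho>))"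
proof -
  interpret \<rho>: prob_space \<rho> by fact
  interpret product_sigma_finite "\<lambda>_. \<rho>" by unfold_locales
  define J where "J = I - {i}"
  have J: "finite J" "i \<notin> J" and IJ: "I = insert i J" using I by (auto simp: J_def)
  have k' [measurable]: "case_prod k \<in> borel_measurable (PiM (insert i J) (\<lambda>_. \<rho>) \<Otimes>\<^sub>M \<rho>)"
    using k unfolding IJ .
  interpret pr: pair_sigma_finite \<rho> \<rho> by unfold_locales
  have [measurable]: "(\<lambda>(S, z). k (S(i := z)) (S i)) \<in> borel_measurable (PiM (insert i J) (\<lambda>_. \<rho>) \<Otimes>\<^sub>M \<rho>)"
  proof -
    have "(\<lambda>x. (fst x)(i := snd x)) \<in> measurable (PiM (insert i J) (\<lambda>_. \<rho>) \<Otimes>\<^sub>M \<rho>) (PiM (insert i J) (\<lambda>_. \<rho>))"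
      by (rule measurable_fun_upd[where J = "insert i J"]) auto
    moreover have "(\<lambda>x. fst x i) \<in> measurable (PiM (insert i J) (\<lambda>_. \<rho>) \<Otimes>\<^sub>M \<rho>) \<rho>"
      by measurable
    ultimately show ?thesis
      using measurable_compose[OF measurable_Pair k'] by (simp add: split_beta')
  qed
  have "(\<integral>\<^sup>+S. \<integral>\<^sup>+z. k (S(i := z)) (S i) \<partial>\<rho> \<partial>PiM I (\<lambda>_. \<rho>))
      = (\<integral>\<^sup>+x. \<integral>\<^sup>+y. \<integral>\<^sup>+z. k (x(i := z)) y \<partial>\<rho> \<partial>\<rho> \<partial>PiM J (\<lambda>_. \<rho>))"
    unfolding IJ by (subst product_nn_integral_insert[OF J]) simp_all
  also have "\<dots> = (\<integral>\<^sup>+x. \<integral>\<^sup>+z. \<integral>\<^sup>+y. k (x(i := z)) y \<partial>\<rho> \<partial>\<rho> \<partial>PiM J (\<lambda>_. \<rho>))"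
  proof (rule nn_integral_cong)
    fix x assume [measurable]: "x \<in> space (PiM J (\<lambda>_. \<rho>))"
    show "(\<integral>\<^sup>+y. \<integral>\<^sup>+z. k (x(i := z)) y \<partial>\<rho> \<partial>\<rho>) = (\<integral>\<^sup>+z. \<integral>\<^sup>+y. k (x(i := z)) y \<partial>\<rho> \<partial>\<rho>)"
      by (rule pr.Fubini'[symmetric]) (simp add: split_beta', measurable)
  qed
  also have "\<dots> = (\<integral>\<^sup>+S. \<integral>\<^sup>+z. k S z \<partial>\<rho> \<partial>PiM I (\<lambda>_. \<rho>))"
    unfolding IJ by (subst product_nn_integral_insert[OF J]) simp_all
  finally show ?thesis .
qed

text \<open>Coordinate \<open>t\<close> is split off the product; \<open>k\<close> is constant in
  it, so the integral factorises. This is independence of one coordinate from a function of the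
  others, in integral form.\<close>

lemma nn_integral_PiM_indep_coordinate:
  assumes A: "\<And>i. prob_space (A i)" and I: "finite I" "t \<in> I"
    and k [measurable]: "k \<in> borel_measurable (PiM I A)"
    and u [measurable]: "u \<in> borel_measurable (A t)"
    and indep: "\<And>x y. k (x(t := y)) = k x"
  shows "(\<integral>\<^sup>+x. u (x t) * k x \<partial>PiM I A) = (\<integral>\<^sup>+y. u y \<partial>A t) * (\<integral>\<^sup>+x. k x \<partial>PiM I A)"
proof -
  interpret A: prob_space "A i" for i by (rule A)
  interpret product_sigma_finite A by unfold_locales
  define J where "J = I - {t}"
  have J: "finite J" "t \<notin> J" and IJ: "I = insert t J" using I by (auto simp: J_def)
  \<comment> \<open>Points of the smaller product are \<open>undefined\<close> at \<open>t\<close>.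
    Filling in some \<open>c\<close> makes them points of the full product, where measurability of
    \<open>k\<close> is known, without changing the value of \<open>k\<close>.\<close>
  obtain c where "c \<in> space (A t)" using A.not_empty by blast
  have k' [measurable]: "k \<in> borel_measurable (PiM (insert t J) A)"
    using k unfolding IJ .
  have [measurable]: "k \<in> borel_measurable (PiM J A)"
  proof -
    have "(\<lambda>x. k (x(t := c))) \<in> borel_measurable (PiM J A)"
      using \<open>c \<in> space (A t)\<close> by measurable
    then show ?thesis by (simp add: indep)
  qed
  have "(\<integral>\<^sup>+x. u (x t) * k x \<partial>PiM I A) = (\<integral>\<^sup>+x. (\<integral>\<^sup>+y. u y \<partial>A t) * k x \<partial>PiM J A)"
    unfolding IJ by (subst product_nn_integral_insert[OF J]) (simp_all add: indep nn_integral_multc)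
  also have "\<dots> = (\<integral>\<^sup>+y. u y \<partial>A t) * (\<integral>\<^sup>+x. k x \<partial>PiM J A)"
    by (rule nn_integral_cmult) measurable
  also have "(\<integral>\<^sup>+x. k x \<partial>PiM J A) = (\<integral>\<^sup>+x. k x \<partial>PiM I A)"
    unfolding IJ by (subst product_nn_integral_insert[OF J]) (simp_all add: indep A.emeasure_space_1)
  finally show ?thesis .
qed

section \<open>On-average model stability of noisy stochastic gradient descent\<close>

text \<open>\<open>N\<close> is the law of one noise vector, \<open>gauss_vec\<close> in the
  application. The condition on \<open>sets N\<close> lets noises be added to weights
  measurably.\<close>

locale noisy_sgd =
  fixes \<rho> :: "'z measure" and N :: "'w::euclidean_space measure"
    and n T :: nat and g :: "'w \<Rightarrow> 'z \<Rightarrow> 'w" and \<eta> :: "nat \<Rightarrow> real"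
  assumes prob_rho: "prob_space \<rho>" and prob_N: "prob_space N" and sets_N: "sets N = sets borel"
    and n: "n \<ge> 1" and T: "T \<ge> 1"
    and g_meas: "(\<lambda>(w, z). g w z) \<in> borel_measurable (borel \<Otimes>\<^sub>M \<rho>)"
begin

definition samples :: "(nat \<Rightarrow> 'z) measure" where
  "samples = PiM {..<n} (\<lambda>_. \<rho>)"

definition indices :: "(nat \<Rightarrow> nat) measure" where
  "indices = PiM {1..T} (\<lambda>_. measure_pmf (pmf_of_set {..<n}))"

definition noises :: "(nat \<Rightarrow> 'w) measure" where
  "noises = PiM {1..T} (\<lambda>_. N)"

definition \<Omega> :: "((nat \<Rightarrow> 'z) \<times> (nat \<Rightarrow> nat) \<times> (nat \<Rightarrow> 'w)) measure" where
  "\<Omega> = samples \<Otimes>\<^sub>M (indices \<Otimes>\<^sub>M noises)"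

text \<open>Reducing the index modulo \<^term>\<open>n\<close> changes nothing almost surely, but makes every iterate
  measurable: an index outside \<^term>\<open>{..<n}\<close> would evaluate the gradient at \<^term>\<open>undefined\<close>.\<close>

definition idx :: "(nat \<Rightarrow> 'z) \<times> (nat \<Rightarrow> nat) \<times> (nat \<Rightarrow> 'w) \<Rightarrow> nat \<Rightarrow> nat" where
  "idx \<omega> t = fst (snd \<omega>) t mod n"

definition iter :: "(nat \<Rightarrow> 'z) \<times> (nat \<Rightarrow> nat) \<times> (nat \<Rightarrow> 'w) \<Rightarrow> nat \<Rightarrow> 'w" where
  "iter \<omega> t = dp_iter g \<eta> (fst \<omega>) (idx \<omega>) (snd (snd \<omega>)) t"

definition avg :: "(nat \<Rightarrow> 'z) \<times> (nat \<Rightarrow> nat) \<times> (nat \<Rightarrow> 'w) \<Rightarrow> 'w" where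
  "avg \<omega> = (1 / real T) *\<^sub>R (\<Sum>t=1..T. iter \<omega> t)"

text \<open>The argument \<^term>\<open>(\<omega>, z)\<close> pairs a run with a ghost example \<^term>\<open>z\<close>.\<close>

definition swap where
  "swap i x = (((fst (fst x))(i := snd x), snd (fst x)), fst (fst x) i)"

sublocale rho: prob_space \<rho> by (rule prob_rho)
sublocale N: prob_space N by (rule prob_N)
sublocale samples: prob_space samples
  unfolding samples_def by (intro prob_space_PiM prob_rho)
sublocale indices: prob_space indices
  unfolding indices_def by (intro prob_space_PiM prob_space_measure_pmf)
sublocale noises: prob_space noises
  unfolding noises_def by (intro prob_space_PiM prob_N)
sublocale IN: pair_prob_space indices noises ..
sublocale \<Omega>: pair_prob_space samples "indices \<Otimes>\<^sub>M noises" ..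
sublocale Om: prob_space \<Omega>
  unfolding \<Omega>_def by (rule \<Omega>.prob_space_axioms)
sublocale ghost: pair_prob_space \<Omega> \<rho> ..

section \<open>Measurability of the iterates\<close>

lemma measurable_sample [measurable]: "i < n \<Longrightarrow> (\<lambda>\<omega>. fst \<omega> i) \<in> measurable \<Omega> \<rho>"
  unfolding \<Omega>_def samples_def by measurable

lemma sample_in_space: "\<omega> \<in> space \<Omega> \<Longrightarrow> i < n \<Longrightarrow> fst \<omega> i \<in> space \<rho>"
  using measurable_space[OF measurable_sample] .

lemma measurable_idx [measurable]:
  assumes "t \<in> {1..T}"
  shows "(\<lambda>\<omega>. idx \<omega> t) \<in> measurable \<Omega> (count_space {..<n})"
proof -
  have [measurable]: "(\<lambda>x. x t) \<in> measurable indices (measure_pmf (pmf_of_set {..<n}))"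
    unfolding indices_def using assms by measurable
  have [measurable]: "(\<lambda>k. k mod n) \<in> measurable (measure_pmf (pmf_of_set {..<n})) (count_space {..<n})"
    using n by (auto simp: measurable_def)
  have "(\<lambda>\<omega>. fst (snd \<omega>)) \<in> measurable \<Omega> indices"
    unfolding \<Omega>_def by measurable
  then show ?thesis
    unfolding idx_def by measurable
qed

lemma measurable_noise [measurable]:
  "t \<in> {1..T} \<Longrightarrow> (\<lambda>\<omega>. snd (snd \<omega>) t) \<in> borel_measurable \<Omega>"
proof -
  assume "t \<in> {1..T}"
  then have "(\<lambda>B. B t) \<in> measurable noises N"
    unfolding noises_def by measurable
  then have [measurable]: "(\<lambda>B. B t) \<in> borel_measurable noises"
    using measurable_cong_sets[OF refl sets_N] by blast
  show ?thesis unfolding \<Omega>_def by measurable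
qed

lemma measurable_pair_fun:
  assumes U: "(\<lambda>(w, z). U w z) \<in> measurable (borel \<Otimes>\<^sub>M \<rho>) B"
    and [measurable]: "a \<in> measurable M borel" "b \<in> measurable M \<rho>"
  shows "(\<lambda>x. U (a x) (b x)) \<in> measurable M B"
  using measurable_compose[OF measurable_Pair[OF assms(2,3)] U] by simp

lemma iter_Suc:
  "t \<ge> 1 \<Longrightarrow> iter \<omega> (Suc t) = iter \<omega> t - \<eta> t *\<^sub>R (g (iter \<omega> t) (fst \<omega> (idx \<omega> t)) + snd (snd \<omega>) t)"
  by (simp add: iter_def)

lemma iter_0 [simp]: "iter \<omega> 0 = 0" and iter_1 [simp]: "iter \<omega> (Suc 0) = 0"
  by (simp_all add: iter_def)

lemma measurable_iter [measurable]:
  "t \<le> T \<Longrightarrow> (\<lambda>\<omega>. iter \<omega> t) \<in> borel_measurable \<Omega>"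
proof (induction t)
  case (Suc t)
  show ?case
  proof (cases "t = 0")
    case False
    then have t [simp]: "t \<in> {1..T}" using Suc.prems by auto
    have [measurable]: "(\<lambda>\<omega>. iter \<omega> t) \<in> borel_measurable \<Omega>" using Suc by simp
    have [measurable]: "(\<lambda>\<omega>. fst \<omega> (idx \<omega> t)) \<in> measurable \<Omega> \<rho>"
      by (rule measurable_compose_countable'[where I = "{..<n}" and f = "\<lambda>k \<omega>. fst \<omega> k"])
        (use measurable_idx[OF t] in auto)
    have [measurable]: "(\<lambda>\<omega>. g (iter \<omega> t) (fst \<omega> (idx \<omega> t))) \<in> borel_measurable \<Omega>"
      by (rule measurable_pair_fun[OF g_meas]) measurable
    have "(\<lambda>\<omega>. iter \<omega> t - \<eta> t *\<^sub>R (g (iter \<omega> t) (fst \<omega> (idx \<omega> t)) + snd (snd \<omega>) t))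
        \<in> borel_measurable \<Omega>"
      by (measurable, rule t)
    then show ?thesis using False by (simp add: iter_Suc)
  qed simp
qed simp

lemma measurable_avg [measurable]: "avg \<in> borel_measurable \<Omega>"
proof -
  have "(\<lambda>\<omega>. avg \<omega>) \<in> borel_measurable \<Omega>"
    unfolding avg_def by (intro borel_measurable_scaleR borel_measurable_sum measurable_iter) auto
  then show ?thesis .
qed

text \<open>Iterate \<open>s\<close> is determined by the indices of steps before \<open>s\<close>;
  this is the sense in which the draw at step \<open>t\<close> is independent of the past.\<close>

lemma iter_idx_update:
  "s \<le> t \<Longrightarrow> iter (S, I(t := k), B) s = iter (S, I, B) s"
proof (induction s)
  case (Suc s)
  show ?case
  proof (cases "s = 0")
    case False
    then show ?thesis using Suc by (simp add: iter_Suc idx_def)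
  qed simp
qed simp

section \<open>Invariance of the joint law under exchange with the ghost example\<close>

lemma measurable_swap [measurable]:
  assumes "i < n"
  shows "swap i \<in> measurable (\<Omega> \<Otimes>\<^sub>M \<rho>) (\<Omega> \<Otimes>\<^sub>M \<rho>)"
proof -
  have *: "insert i {..<n} = {..<n}" using assms by auto
  have [measurable]: "(\<lambda>x. fst (fst x)) \<in> measurable (\<Omega> \<Otimes>\<^sub>M \<rho>) (PiM {..<n} (\<lambda>_. \<rho>))"
    unfolding \<Omega>_def samples_def by measurable
  have 1: "(\<lambda>x. (fst (fst x))(i := snd x)) \<in> measurable (\<Omega> \<Otimes>\<^sub>M \<rho>) samples"
    unfolding samples_def
    by (rule measurable_fun_upd[where J = "{..<n}"]) (use * in auto)
  have 2: "(\<lambda>x. snd (fst x)) \<in> measurable (\<Omega> \<Otimes>\<^sub>M \<rho>) (indices \<Otimes>\<^sub>M noises)"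
    unfolding \<Omega>_def by measurable
  have "(\<lambda>x. ((fst (fst x))(i := snd x), snd (fst x))) \<in> measurable (\<Omega> \<Otimes>\<^sub>M \<rho>) \<Omega>"
    using measurable_Pair[OF 1 2] by (simp add: \<Omega>_def)
  moreover have "(\<lambda>x. fst (fst x) i) \<in> measurable (\<Omega> \<Otimes>\<^sub>M \<rho>) \<rho>"
    using assms by measurable
  ultimately show ?thesis
    unfolding swap_def[abs_def] by (rule measurable_Pair)
qed

lemma nn_integral_iterated:
  assumes [measurable]: "h \<in> borel_measurable (\<Omega> \<Otimes>\<^sub>M \<rho>)"
  shows "(\<integral>\<^sup>+x. h x \<partial>(\<Omega> \<Otimes>\<^sub>M \<rho>)) = (\<integral>\<^sup>+S. \<integral>\<^sup>+r. \<integral>\<^sup>+z. h ((S, r), z) \<partial>\<rho> \<partial>(indices \<Otimes>\<^sub>M noises) \<partial>samples)"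
proof -
  have [measurable]: "(\<lambda>\<omega>. \<integral>\<^sup>+z. h (\<omega>, z) \<partial>\<rho>) \<in> borel_measurable (samples \<Otimes>\<^sub>M (indices \<Otimes>\<^sub>M noises))"
    unfolding \<Omega>_def[symmetric] by measurable
  show ?thesis
    by (subst rho.nn_integral_fst[symmetric], simp)
      (subst \<Omega>_def, subst IN.nn_integral_fst[symmetric], simp_all)
qed

text \<open>\<open>swap i\<close> transposes two independent draws from \<open>\<rho>\<close> and
  leaves indices and noises alone. In the iterated integral the ghost example is innermost, so
  Fubini moves it next to the sample, where the exchange of coordinates acts, and then back.\<close>

lemma distr_swap:
  assumes i: "i < n"
  shows "distr (\<Omega> \<Otimes>\<^sub>M \<rho>) (\<Omega> \<Otimes>\<^sub>M \<rho>) (swap i) = \<Omega> \<Otimes>\<^sub>M \<rho>"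
proof (rule measure_eqI)
  fix A assume "A \<in> sets (distr (\<Omega> \<Otimes>\<^sub>M \<rho>) (\<Omega> \<Otimes>\<^sub>M \<rho>) (swap i))"
  then have A [measurable]: "A \<in> sets (\<Omega> \<Otimes>\<^sub>M \<rho>)" by simp
  define h :: "_ \<Rightarrow> ennreal" where "h = indicator A"
  have h [measurable]: "h \<in> borel_measurable (\<Omega> \<Otimes>\<^sub>M \<rho>)" by (simp add: h_def)
  have h' [measurable]: "h \<in> borel_measurable ((samples \<Otimes>\<^sub>M (indices \<Otimes>\<^sub>M noises)) \<Otimes>\<^sub>M \<rho>)"
    using h unfolding \<Omega>_def .
  have flip: "(\<integral>\<^sup>+r. \<integral>\<^sup>+z. q r z \<partial>\<rho> \<partial>(indices \<Otimes>\<^sub>M noises)) = (\<integral>\<^sup>+z. \<integral>\<^sup>+r. q r z \<partial>(indices \<Otimes>\<^sub>M noises) \<partial>\<rho>)"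
    if "case_prod q \<in> borel_measurable ((indices \<Otimes>\<^sub>M noises) \<Otimes>\<^sub>M \<rho>)" for q :: "_ \<Rightarrow> _ \<Rightarrow> ennreal"
  proof -
    interpret pair_sigma_finite "indices \<Otimes>\<^sub>M noises" \<rho> ..
    show ?thesis using Fubini'[OF that] by simp
  qed
  have hs: "(\<lambda>x. h (swap i x)) \<in> borel_measurable ((samples \<Otimes>\<^sub>M (indices \<Otimes>\<^sub>M noises)) \<Otimes>\<^sub>M \<rho>)"
    using measurable_compose[OF measurable_swap[OF i] h] unfolding \<Omega>_def .
  have "emeasure (distr (\<Omega> \<Otimes>\<^sub>M \<rho>) (\<Omega> \<Otimes>\<^sub>M \<rho>) (swap i)) A = (\<integral>\<^sup>+x. h (swap i x) \<partial>(\<Omega> \<Otimes>\<^sub>M \<rho>))"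
    using i A by (simp add: nn_integral_indicator[symmetric] nn_integral_distr h_def del: nn_integral_indicator)
  also have "\<dots> = (\<integral>\<^sup>+S. \<integral>\<^sup>+r. \<integral>\<^sup>+z. h ((S(i := z), r), S i) \<partial>\<rho> \<partial>(indices \<Otimes>\<^sub>M noises) \<partial>samples)"
    using measurable_compose[OF measurable_swap[OF i] h]
    by (subst nn_integral_iterated) (simp_all add: swap_def)
  also have "\<dots> = (\<integral>\<^sup>+S. \<integral>\<^sup>+z. \<integral>\<^sup>+r. h ((S(i := z), r), S i) \<partial>(indices \<Otimes>\<^sub>M noises) \<partial>\<rho> \<partial>samples)"
  proof (rule nn_integral_cong, rule flip)
    fix S assume [measurable]: "S \<in> space samples"
    have "(\<lambda>y. h (swap i ((S, fst y), snd y))) \<in> borel_measurable ((indices \<Otimes>\<^sub>M noises) \<Otimes>\<^sub>M \<rho>)"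
      by (rule measurable_compose[OF _ hs]) measurable
    then show "(\<lambda>(r, z). h ((S(i := z), r), S i)) \<in> borel_measurable ((indices \<Otimes>\<^sub>M noises) \<Otimes>\<^sub>M \<rho>)"
      by (simp add: swap_def split_beta')
  qed
  also have "\<dots> = (\<integral>\<^sup>+S. \<integral>\<^sup>+z. \<integral>\<^sup>+r. h ((S, r), z) \<partial>(indices \<Otimes>\<^sub>M noises) \<partial>\<rho> \<partial>samples)"
    unfolding samples_def
  proof (rule nn_integral_PiM_swap[OF prob_rho])
    have "(\<lambda>(S, z). \<integral>\<^sup>+r. h ((S, r), z) \<partial>(indices \<Otimes>\<^sub>M noises)) \<in> borel_measurable (samples \<Otimes>\<^sub>M \<rho>)"
      by measurable
    then show "(\<lambda>(S, z). \<integral>\<^sup>+r. h ((S, r), z) \<partial>(indices \<Otimes>\<^sub>M noises))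
        \<in> borel_measurable (PiM {..<n} (\<lambda>_. \<rho>) \<Otimes>\<^sub>M \<rho>)"
      unfolding samples_def .
  qed (use i in auto)
  also have "\<dots> = (\<integral>\<^sup>+S. \<integral>\<^sup>+r. \<integral>\<^sup>+z. h ((S, r), z) \<partial>\<rho> \<partial>(indices \<Otimes>\<^sub>M noises) \<partial>samples)"
    by (rule nn_integral_cong, rule flip[symmetric]) measurable
  also have "\<dots> = (\<integral>\<^sup>+x. h x \<partial>(\<Omega> \<Otimes>\<^sub>M \<rho>))"
    by (rule nn_integral_iterated[symmetric]) measurable
  also have "\<dots> = emeasure (\<Omega> \<Otimes>\<^sub>M \<rho>) A" by (simp add: h_def)
  finally show "emeasure (distr (\<Omega> \<Otimes>\<^sub>M \<rho>) (\<Omega> \<Otimes>\<^sub>M \<rho>) (swap i)) A = emeasure (\<Omega> \<Otimes>\<^sub>M \<rho>) A" .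
qed simp

lemma nn_integral_swap:
  assumes "i < n" "h \<in> borel_measurable (\<Omega> \<Otimes>\<^sub>M \<rho>)"
  shows "(\<integral>\<^sup>+x. h (swap i x) \<partial>(\<Omega> \<Otimes>\<^sub>M \<rho>)) = (\<integral>\<^sup>+x. h x \<partial>(\<Omega> \<Otimes>\<^sub>M \<rho>))"
  using nn_integral_distr[OF measurable_swap[OF assms(1)], of h] assms by (simp add: distr_swap)

lemma integral_swap:
  fixes h :: "_ \<Rightarrow> real"
  assumes "i < n" "h \<in> borel_measurable (\<Omega> \<Otimes>\<^sub>M \<rho>)"
  shows "(\<integral>x. h (swap i x) \<partial>(\<Omega> \<Otimes>\<^sub>M \<rho>)) = (\<integral>x. h x \<partial>(\<Omega> \<Otimes>\<^sub>M \<rho>))"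
  using integral_distr[OF measurable_swap[OF assms(1)], of h] assms by (simp add: distr_swap)

lemma integrable_swap:
  fixes h :: "_ \<Rightarrow> real"
  assumes "i < n" "integrable (\<Omega> \<Otimes>\<^sub>M \<rho>) h"
  shows "integrable (\<Omega> \<Otimes>\<^sub>M \<rho>) (\<lambda>x. h (swap i x))"
  using integrable_distr[OF measurable_swap[OF assms(1)], of h] assms by (simp add: distr_swap)

lemma nn_integral_Om:
  assumes "h \<in> borel_measurable \<Omega>"
  shows "(\<integral>\<^sup>+x. h (fst x) \<partial>(\<Omega> \<Otimes>\<^sub>M \<rho>)) = (\<integral>\<^sup>+\<omega>. h \<omega> \<partial>\<Omega>)"
  using nn_integral_distr[of fst "\<Omega> \<Otimes>\<^sub>M \<rho>" \<Omega> h] assms by (simp add: rho.distr_pair_fst)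

lemma integral_Om:
  fixes h :: "_ \<Rightarrow> real"
  assumes "h \<in> borel_measurable \<Omega>"
  shows "(\<integral>x. h (fst x) \<partial>(\<Omega> \<Otimes>\<^sub>M \<rho>)) = (\<integral>\<omega>. h \<omega> \<partial>\<Omega>)"
  using integral_distr[of fst "\<Omega> \<Otimes>\<^sub>M \<rho>" \<Omega> h] assms by (simp add: rho.distr_pair_fst)

lemma integrable_Om:
  fixes h :: "_ \<Rightarrow> real"
  assumes "integrable \<Omega> h"
  shows "integrable (\<Omega> \<Otimes>\<^sub>M \<rho>) (\<lambda>x. h (fst x))"
  using integrable_distr[of fst "\<Omega> \<Otimes>\<^sub>M \<rho>" \<Omega> h] assms by (simp add: rho.distr_pair_fst)

text \<open>The index at step \<open>t\<close> is uniform and \<open>h\<close> does not see it, so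
  the event contributes the factor \<open>1 / n\<close>. Noises and ghost are integrated out first,
  leaving for each sample a function \<open>K S\<close> of the indices alone, from which coordinate
  \<open>t\<close> can be factored.\<close>

lemma nn_integral_idx_indep:
  assumes i: "i < n" and t: "t \<in> {1..T}"
    and h [measurable]: "h \<in> borel_measurable (\<Omega> \<Otimes>\<^sub>M \<rho>)"
    and indep: "\<And>S I B z k. h ((S, I(t := k), B), z) = h ((S, I, B), z)"
  shows "(\<integral>\<^sup>+x. indicator {x. idx (fst x) t = i} x * h x \<partial>(\<Omega> \<Otimes>\<^sub>M \<rho>))
    = ennreal (1 / real n) * (\<integral>\<^sup>+x. h x \<partial>(\<Omega> \<Otimes>\<^sub>M \<rho>))"
proof -
  let ?P = "measure_pmf (pmf_of_set {..<n})"
  \<comment> \<open>The residue is used, as in \<open>idx\<close>; among the possible draws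
    \<open>{..<n}\<close> only \<open>i\<close> itself has residue \<open>i\<close>.\<close>
  define u :: "nat \<Rightarrow> ennreal" where "u k = indicator {k. k mod n = i} k" for k
  have u: "(\<integral>\<^sup>+k. u k \<partial>?P) = ennreal (1 / real n)"
  proof -
    have "{..<n} \<inter> {k. k mod n = i} = {i}" using i by auto
    then show ?thesis
      using n i by (simp add: u_def[abs_def] emeasure_pmf_of_set lessThan_empty_iff ennreal_divide_numeral
          measure_pmf.emeasure_eq_measure measure_pmf_of_set)
  qed
  have [measurable]: "(\<lambda>x. indicator {x. idx (fst x) t = i} x :: ennreal) \<in> borel_measurable (\<Omega> \<Otimes>\<^sub>M \<rho>)"
  proof -
    have "(\<lambda>x. idx (fst x) t) \<in> measurable (\<Omega> \<Otimes>\<^sub>M \<rho>) (count_space {..<n})"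
      by (rule measurable_compose[OF measurable_fst measurable_idx[OF t]])
    then have "(\<lambda>x. indicator {i} (idx (fst x) t) :: ennreal) \<in> borel_measurable (\<Omega> \<Otimes>\<^sub>M \<rho>)"
      by (rule measurable_compose) simp
    moreover have "indicator {x. idx (fst x) t = i} x = (indicator {i} (idx (fst x) t) :: ennreal)" for x :: "_ \<times> 'z"
      by (simp add: indicator_def)
    ultimately show ?thesis by simp
  qed
  have h' [measurable]: "h \<in> borel_measurable ((samples \<Otimes>\<^sub>M (indices \<Otimes>\<^sub>M noises)) \<Otimes>\<^sub>M \<rho>)"
    using h unfolding \<Omega>_def .
  have mu: "(\<lambda>x. u (x t)) \<in> borel_measurable indices"
    unfolding indices_def using t by measurable
  note [measurable] = measurable_compose[OF measurable_fst mu]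
  define K where "K S I = (\<integral>\<^sup>+B. \<integral>\<^sup>+z. h ((S, I, B), z) \<partial>\<rho> \<partial>noises)" for S I
  have K [measurable]: "K S \<in> borel_measurable indices" if [measurable]: "S \<in> space samples" for S
    unfolding K_def by measurable
  have "(\<integral>\<^sup>+x. indicator {x. idx (fst x) t = i} x * h x \<partial>(\<Omega> \<Otimes>\<^sub>M \<rho>))
      = (\<integral>\<^sup>+S. \<integral>\<^sup>+r. \<integral>\<^sup>+z. u (fst r t) * h ((S, r), z) \<partial>\<rho> \<partial>(indices \<Otimes>\<^sub>M noises) \<partial>samples)"
    by (subst nn_integral_iterated, simp) (simp add: idx_def u_def indicator_def)
  also have "\<dots> = (\<integral>\<^sup>+S. \<integral>\<^sup>+I. u (I t) * K S I \<partial>indices \<partial>samples)"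
  proof (rule nn_integral_cong)
    fix S assume [measurable]: "S \<in> space samples"
    have "(\<integral>\<^sup>+r. \<integral>\<^sup>+z. u (fst r t) * h ((S, r), z) \<partial>\<rho> \<partial>(indices \<Otimes>\<^sub>M noises))
        = (\<integral>\<^sup>+r. u (fst r t) * (\<integral>\<^sup>+z. h ((S, r), z) \<partial>\<rho>) \<partial>(indices \<Otimes>\<^sub>M noises))"
      by (intro nn_integral_cong nn_integral_cmult) measurable
    also have "\<dots> = (\<integral>\<^sup>+I. \<integral>\<^sup>+B. u (I t) * (\<integral>\<^sup>+z. h ((S, I, B), z) \<partial>\<rho>) \<partial>noises \<partial>indices)"
      by (subst noises.nn_integral_fst[symmetric]) simp_all
    also have "\<dots> = (\<integral>\<^sup>+I. u (I t) * K S I \<partial>indices)"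
      unfolding K_def by (intro nn_integral_cong nn_integral_cmult) measurable
    finally show "(\<integral>\<^sup>+r. \<integral>\<^sup>+z. u (fst r t) * h ((S, r), z) \<partial>\<rho> \<partial>(indices \<Otimes>\<^sub>M noises))
        = (\<integral>\<^sup>+I. u (I t) * K S I \<partial>indices)" .
  qed
  also have "\<dots> = (\<integral>\<^sup>+S. ennreal (1 / real n) * (\<integral>\<^sup>+I. K S I \<partial>indices) \<partial>samples)"
  proof (rule nn_integral_cong)
    fix S assume "S \<in> space samples"
    moreover have "K S (I(t := k)) = K S I" for I k
      by (simp add: K_def indep)
    ultimately show "(\<integral>\<^sup>+I. u (I t) * K S I \<partial>indices) = ennreal (1 / real n) * (\<integral>\<^sup>+I. K S I \<partial>indices)"
      using K[of S] t unfolding indices_def u[symmetric]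
      by (intro nn_integral_PiM_indep_coordinate prob_space_measure_pmf) auto
  qed
  also have "\<dots> = ennreal (1 / real n) * (\<integral>\<^sup>+S. \<integral>\<^sup>+I. K S I \<partial>indices \<partial>samples)"
    unfolding K_def by (rule nn_integral_cmult) measurable
  also have "(\<integral>\<^sup>+S. \<integral>\<^sup>+I. K S I \<partial>indices \<partial>samples) = (\<integral>\<^sup>+x. h x \<partial>(\<Omega> \<Otimes>\<^sub>M \<rho>))"
    unfolding K_def
    by (subst nn_integral_iterated, simp, intro nn_integral_cong)
      (subst noises.nn_integral_fst[symmetric], simp_all)
  finally show ?thesis .
qed

section \<open>Growth of the distance between the two coupled runs\<close>

text \<open>On the event that step \<^term>\<open>t\<close> uses the exchanged example, the squared distance is split by
  \<^term>\<open>(a + b)\<^sup>2 \<le> (1 + p) * a\<^sup>2 + (1 + 1 / p) * b\<^sup>2\<close>; since the event has probability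
  \<^term>\<open>1 / n\<close>, the choice \<^term>\<open>p = n / T\<close> makes the distance grow by \<^term>\<open>1 + 1 / T\<close> per step.\<close>

lemma iter_distance_step:
  fixes x i t
  defines "w \<equiv> iter (fst x) t" and "w' \<equiv> iter (fst (swap i x)) t"
  assumes t: "t \<ge> 1" and K: "K \<ge> 0" and i: "i < n"
    and x: "x \<in> space (\<Omega> \<Otimes>\<^sub>M \<rho>)"
    and step: "\<And>w w' z. z \<in> space \<rho> \<Longrightarrow>
      (norm ((w - \<eta> t *\<^sub>R g w z) - (w' - \<eta> t *\<^sub>R g w' z)))\<^sup>2 \<le> (norm (w - w'))\<^sup>2 + a"
    and bound: "\<And>w z. z \<in> space \<rho> \<Longrightarrow> (norm (g w z))\<^sup>2 \<le> K * U w z"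
    and a: "a \<ge> 0" and p: "p > 0"
  shows "(norm (iter (fst x) (Suc t) - iter (fst (swap i x)) (Suc t)))\<^sup>2
    \<le> (norm (w - w'))\<^sup>2 + a + indicator {x. idx (fst x) t = i} x *
      (p * (norm (w - w'))\<^sup>2 + 2 * (1 + 1 / p) * (\<eta> t)\<^sup>2 * K * (U w (fst (fst x) i) + U w' (snd x)))"
proof -
  obtain S I B z where xe: "x = ((S, I, B), z)" by (metis prod.collapse)
  have S: "S k \<in> space \<rho>" if "k < n" for k
    using x that by (auto simp: xe \<Omega>_def samples_def space_pair_measure space_PiM PiE_def Pi_def)
  have z: "z \<in> space \<rho>" using x by (auto simp: xe space_pair_measure)
  define j where "j = idx (S, I, B) t"
  have j: "j < n" using n by (simp add: j_def idx_def)
  have e: "iter (fst x) (Suc t) = w - \<eta> t *\<^sub>R (g w (S j) + B t)"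
    using t by (simp add: w_def xe iter_Suc j_def)
  have e': "iter (fst (swap i x)) (Suc t) = w' - \<eta> t *\<^sub>R (g w' ((S(i := z)) j) + B t)"
    using t by (simp add: w'_def xe iter_Suc j_def swap_def idx_def)
  have d: "iter (fst x) (Suc t) - iter (fst (swap i x)) (Suc t)
      = (w - \<eta> t *\<^sub>R g w (S j)) - (w' - \<eta> t *\<^sub>R g w' ((S(i := z)) j))"
    unfolding e e' by (simp add: algebra_simps)
  show ?thesis
  proof (cases "j = i")
    case False
    then show ?thesis
      using step[OF S[OF j], of w w'] unfolding d by (simp add: xe j_def indicator_def)
  next
    case True
    \<comment> \<open>The runs now take gradients at different examples, \<open>S i\<close> and
      \<open>z\<close>, so no contraction is available: the gradient difference is bounded by the
      sum of the norms, and the hypothesis \<open>bound\<close> handles each norm.\<close>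
    define A where "A = norm (w - w')"
    define C where "C = \<bar>\<eta> t\<bar> * (norm (g w (S i)) + norm (g w' z))"
    have "norm (iter (fst x) (Suc t) - iter (fst (swap i x)) (Suc t))
        = norm ((w - w') - \<eta> t *\<^sub>R (g w (S i) - g w' z))"
      unfolding d using True by (simp add: algebra_simps)
    also have "\<dots> \<le> A + \<bar>\<eta> t\<bar> * norm (g w (S i) - g w' z)"
      unfolding A_def using norm_triangle_ineq4[of "w - w'" "\<eta> t *\<^sub>R (g w (S i) - g w' z)"] by simp
    also have "\<dots> \<le> A + C"
      unfolding C_def by (intro add_left_mono mult_left_mono norm_triangle_ineq4) simp
    finally have "(norm (iter (fst x) (Suc t) - iter (fst (swap i x)) (Suc t)))\<^sup>2 \<le> (A + C)\<^sup>2"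
      by (intro power_mono) auto
    also have "\<dots> \<le> (1 + p) * A\<^sup>2 + (1 + 1 / p) * C\<^sup>2"
    proof -
      have "0 \<le> (p * A - C)\<^sup>2 / p" using p by simp
      also have "\<dots> = p * A\<^sup>2 - 2 * A * C + C\<^sup>2 / p"
        using p by (simp add: field_simps power2_eq_square)
      finally show ?thesis by (simp add: algebra_simps power2_eq_square)
    qed
    also have "(1 + 1 / p) * C\<^sup>2 \<le> (1 + 1 / p) * (2 * (\<eta> t)\<^sup>2 * K * (U w (S i) + U w' z))"
    proof (rule mult_left_mono)
      have "C\<^sup>2 = (\<eta> t)\<^sup>2 * (norm (g w (S i)) + norm (g w' z))\<^sup>2"
        by (simp add: C_def power_mult_distrib)
      also have "\<dots> \<le> (\<eta> t)\<^sup>2 * (2 * (norm (g w (S i)))\<^sup>2 + 2 * (norm (g w' z))\<^sup>2)"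
        using sum_squares_bound[of "norm (g w (S i))" "norm (g w' z)"]
        by (intro mult_left_mono) (auto simp: power2_sum)
      also have "\<dots> \<le> (\<eta> t)\<^sup>2 * (2 * (K * U w (S i)) + 2 * (K * U w' z))"
        using bound[OF S[OF i], of w] bound[OF z, of w'] by (intro mult_left_mono) auto
      finally show "C\<^sup>2 \<le> 2 * (\<eta> t)\<^sup>2 * K * (U w (S i) + U w' z)" by (simp add: algebra_simps)
    qed (use p in simp)
    also have "(1 + p) * A\<^sup>2 + (1 + 1 / p) * (2 * (\<eta> t)\<^sup>2 * K * (U w (S i) + U w' z))
        = A\<^sup>2 + (p * A\<^sup>2 + 2 * (1 + 1 / p) * (\<eta> t)\<^sup>2 * K * (U w (S i) + U w' z))"
      by (simp add: distrib_right mult.assoc)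
    finally show ?thesis
      using a True by (simp add: A_def xe j_def[symmetric])
  qed
qed

text \<open>Both parts instantiate this context: the smooth case with \<open>U = f\<close>,
  \<open>K = 2 * L\<close> and \<open>a = 0\<close>, the Hoelder case with \<open>U\<close> a
  fractional power of \<open>f\<close>, \<open>K\<close> the square of \<open>c_a1\<close> and
  \<open>a t\<close> the excess of a step that is not nonexpansive.\<close>

context
  fixes U :: "'w \<Rightarrow> 'z \<Rightarrow> real" and K :: real and a :: "nat \<Rightarrow> real"
  assumes U_meas: "(\<lambda>(w, z). U w z) \<in> borel_measurable (borel \<Otimes>\<^sub>M \<rho>)"
    and U_nonneg: "\<And>w z. z \<in> space \<rho> \<Longrightarrow> 0 \<le> U w z"
    and K_nonneg: "K \<ge> 0"
    and a_nonneg: "\<And>t. t \<in> {1..T} \<Longrightarrow> a t \<ge> 0"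
    and step: "\<And>t w w' z. t \<in> {1..T} \<Longrightarrow> z \<in> space \<rho> \<Longrightarrow>
      (norm ((w - \<eta> t *\<^sub>R g w z) - (w' - \<eta> t *\<^sub>R g w' z)))\<^sup>2 \<le> (norm (w - w'))\<^sup>2 + a t"
    and gradient_bound: "\<And>w z. z \<in> space \<rho> \<Longrightarrow> (norm (g w z))\<^sup>2 \<le> K * U w z"
    and U_int: "\<And>t i. t \<in> {1..T} \<Longrightarrow> i < n \<Longrightarrow> integrable \<Omega> (\<lambda>\<omega>. U (iter \<omega> t) (fst \<omega> i))"
begin

text \<open>The additive growth of the expected squared distance in step \<open>t\<close>, on top of
  the factor \<open>1 + 1 / T\<close>. The division of the second term by \<open>n\<close> is the
  probability that the exchanged example is drawn.\<close>

definition increment where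
  "increment i t = a t + 4 * (1 + real T / real n) * (\<eta> t)\<^sup>2 * K / real n *
     (\<integral>\<omega>. U (iter \<omega> t) (fst \<omega> i) \<partial>\<Omega>)"

lemma increment_nonneg:
  assumes "i < n" "t \<in> {1..T}"
  shows "0 \<le> increment i t"
proof -
  have "0 \<le> (\<integral>\<omega>. U (iter \<omega> t) (fst \<omega> i) \<partial>\<Omega>)"
    using assms by (intro Bochner_Integration.integral_nonneg U_nonneg sample_in_space) auto
  then show ?thesis
    unfolding increment_def using assms a_nonneg[of t] K_nonneg by simp
qed

lemma measurable_distance [measurable]:
  assumes "i < n" "t \<le> T"
  shows "(\<lambda>x. ennreal ((norm (iter (fst x) t - iter (fst (swap i x)) t))\<^sup>2)) \<in> borel_measurable (\<Omega> \<Otimes>\<^sub>M \<rho>)"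
proof -
  have [measurable]: "(\<lambda>x. iter (fst x) t) \<in> borel_measurable (\<Omega> \<Otimes>\<^sub>M \<rho>)"
    using measurable_iter[OF assms(2)] by measurable
  have [measurable]: "(\<lambda>x. iter (fst (swap i x)) t) \<in> borel_measurable (\<Omega> \<Otimes>\<^sub>M \<rho>)"
    using measurable_compose[OF measurable_swap[OF assms(1)], of "\<lambda>x. iter (fst x) t" borel] by simp
  show ?thesis by measurable
qed

text \<open>The pointwise bound is integrated with two invariances: the exchange gives both losses
  in it the same expectation, and independence of the index turns the indicator into
  \<open>1 / n\<close>, so that the weight \<open>p\<close> contributes
  \<open>p / n = 1 / T\<close>.\<close>

lemma nn_integral_distance_step:
  assumes i: "i < n" and t: "t \<in> {1..T}" "Suc t \<le> T"
  shows "(\<integral>\<^sup>+x. ennreal ((norm (iter (fst x) (Suc t) - iter (fst (swap i x)) (Suc t)))\<^sup>2) \<partial>(\<Omega> \<Otimes>\<^sub>M \<rho>))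
    \<le> ennreal (1 + 1 / real T) *
        (\<integral>\<^sup>+x. ennreal ((norm (iter (fst x) t - iter (fst (swap i x)) t))\<^sup>2) \<partial>(\<Omega> \<Otimes>\<^sub>M \<rho>))
      + ennreal (increment i t)"
proof -
  let ?E = "\<Omega> \<Otimes>\<^sub>M \<rho>"
  define p where "p = real n / real T"
  have p: "p > 0" using n T by (simp add: p_def)
  define c where "c = 2 * (1 + 1 / p) * (\<eta> t)\<^sup>2 * K"
  have c: "c \<ge> 0" using p K_nonneg by (simp add: c_def)
  define \<Delta> where "\<Delta> x = ennreal ((norm (iter (fst x) t - iter (fst (swap i x)) t))\<^sup>2)" for x
  define V where "V x = ennreal (U (iter (fst x) t) (fst (fst x) i))" for x :: "_ \<times> 'z"
  have tT: "t \<le> T" using t by simp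
  have \<Delta> [measurable]: "\<Delta> \<in> borel_measurable ?E"
    unfolding \<Delta>_def by (rule measurable_distance[OF i tT])
  have U_om [measurable]: "(\<lambda>\<omega>. U (iter \<omega> t) (fst \<omega> i)) \<in> borel_measurable \<Omega>"
    using U_int[OF t(1) i] by (rule borel_measurable_integrable)
  have V [measurable]: "V \<in> borel_measurable ?E"
    unfolding V_def by measurable
  have V' [measurable]: "(\<lambda>x. V (swap i x)) \<in> borel_measurable ?E"
    using measurable_compose[OF measurable_swap[OF i] V] .
  define v where "v = (\<integral>\<omega>. U (iter \<omega> t) (fst \<omega> i) \<partial>\<Omega>)"
  have v: "(\<integral>\<^sup>+x. V x \<partial>?E) = ennreal v"
  proof -
    have "(\<integral>\<^sup>+x. V x \<partial>?E) = (\<integral>\<^sup>+\<omega>. ennreal (U (iter \<omega> t) (fst \<omega> i)) \<partial>\<Omega>)"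
      unfolding V_def by (rule nn_integral_Om) measurable
    also have "\<dots> = ennreal v"
      unfolding v_def using U_int[OF t(1) i] i
      by (intro nn_integral_eq_integral AE_I2 U_nonneg sample_in_space)
    finally show ?thesis .
  qed
  have v0: "v \<ge> 0"
    unfolding v_def using i by (intro Bochner_Integration.integral_nonneg U_nonneg sample_in_space) auto
  define h where "h x = ennreal p * \<Delta> x + ennreal c * (V x + V (swap i x))" for x
  have [measurable]: "h \<in> borel_measurable ?E" unfolding h_def by measurable
  \<comment> \<open>Iterates at time \<open>t\<close>, in the run and in its perturbed copy, ignore
    the index drawn at step \<open>t\<close>; this allows the indicator to be factored out.\<close>
  have h_indep: "h ((S, I(t := k), B), z) = h ((S, I, B), z)" for S I B z k
    by (simp add: h_def \<Delta>_def V_def swap_def iter_idx_update)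
  have ind: "(\<lambda>x. indicator {x. idx (fst x) t = i} x * h x :: ennreal) \<in> borel_measurable ?E"
  proof -
    have [measurable]: "(\<lambda>x. idx (fst x) t) \<in> measurable ?E (count_space {..<n})"
      by (rule measurable_compose[OF measurable_fst measurable_idx[OF t(1)]])
    have "(\<lambda>x. (if idx (fst x) t = i then h x else 0)) \<in> borel_measurable ?E" by measurable
    then show ?thesis by (rule measurable_cong[THEN iffD1, rotated]) (simp add: indicator_def)
  qed
  have "(\<integral>\<^sup>+x. ennreal ((norm (iter (fst x) (Suc t) - iter (fst (swap i x)) (Suc t)))\<^sup>2) \<partial>?E)
      \<le> (\<integral>\<^sup>+x. (\<Delta> x + ennreal (a t)) + indicator {x. idx (fst x) t = i} x * h x \<partial>?E)"
  proof (rule nn_integral_mono)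
    fix x assume x: "x \<in> space ?E"
    have sx: "swap i x \<in> space ?E"
      using measurable_space[OF measurable_swap[OF i] x] .
    have pos: "0 \<le> U (iter (fst x) t) (fst (fst x) i)" "0 \<le> U (iter (fst (swap i x)) t) (snd x)"
      using x i by (auto intro!: U_nonneg sample_in_space simp: space_pair_measure)
    have Vs: "V (swap i x) = ennreal (U (iter (fst (swap i x)) t) (snd x))"
      by (simp add: V_def swap_def)
    have "(norm (iter (fst x) (Suc t) - iter (fst (swap i x)) (Suc t)))\<^sup>2
      \<le> (norm (iter (fst x) t - iter (fst (swap i x)) t))\<^sup>2 + a t + indicator {x. idx (fst x) t = i} x *
       (p * (norm (iter (fst x) t - iter (fst (swap i x)) t))\<^sup>2
         + c * (U (iter (fst x) t) (fst (fst x) i) + U (iter (fst (swap i x)) t) (snd x)))"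
      unfolding c_def
      by (rule iter_distance_step[OF _ K_nonneg i x step gradient_bound a_nonneg p])
        (use t in auto)
    from ennreal_leI[OF this]
    show "ennreal ((norm (iter (fst x) (Suc t) - iter (fst (swap i x)) (Suc t)))\<^sup>2)
        \<le> (\<Delta> x + ennreal (a t)) + indicator {x. idx (fst x) t = i} x * h x"
      unfolding h_def Vs unfolding \<Delta>_def V_def
      using p c pos a_nonneg[OF t(1)]
      by (auto simp: ennreal_plus ennreal_mult'' ennreal_mult indicator_def)
  qed
  also have "\<dots> = (\<integral>\<^sup>+x. \<Delta> x \<partial>?E) + ennreal (a t) + ennreal (1 / real n) * (\<integral>\<^sup>+x. h x \<partial>?E)"
    using ind nn_integral_idx_indep[OF i t(1) _ h_indep]
    by (subst nn_integral_add) (simp_all add: nn_integral_add ghost.emeasure_space_1)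
  also have "(\<integral>\<^sup>+x. h x \<partial>?E) = ennreal p * (\<integral>\<^sup>+x. \<Delta> x \<partial>?E) + ennreal (2 * c * v)"
  proof -
    have "(\<integral>\<^sup>+x. h x \<partial>?E) = ennreal p * (\<integral>\<^sup>+x. \<Delta> x \<partial>?E) + ennreal c * (ennreal v + ennreal v)"
      unfolding h_def
      by (simp add: nn_integral_add nn_integral_cmult v nn_integral_swap[OF i V])
    also have "ennreal c * (ennreal v + ennreal v) = ennreal (2 * c * v)"
      using c v0 by (simp add: ennreal_plus[symmetric] ennreal_mult[symmetric] del: ennreal_plus)
    finally show ?thesis .
  qed
  also have "(\<integral>\<^sup>+x. \<Delta> x \<partial>?E) + ennreal (a t) + ennreal (1 / real n) * (ennreal p * (\<integral>\<^sup>+x. \<Delta> x \<partial>?E) + ennreal (2 * c * v))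
      = ennreal (1 + 1 / real T) * (\<integral>\<^sup>+x. \<Delta> x \<partial>?E) + ennreal (increment i t)"
  proof -
    have 1: "1 / real n * p = 1 / real T" using n by (simp add: p_def)
    have 2: "increment i t = a t + 1 / real n * (2 * c * v)"
      unfolding increment_def v_def[symmetric] c_def p_def by simp
    have "ennreal (1 / real n) * (ennreal p * D + ennreal (2 * c * v))
        = ennreal (1 / real T) * D + ennreal (1 / real n * (2 * c * v))" for D
      using p c v0 by (simp add: distrib_left ennreal_mult[symmetric] mult.assoc[symmetric] 1[simplified])
    moreover have "ennreal (1 + 1 / real T) * D = D + ennreal (1 / real T) * D" for D
      by (simp add: distrib_right)
    moreover have "ennreal (increment i t) = ennreal (a t) + ennreal (1 / real n * (2 * c * v))"
      unfolding 2 using a_nonneg[OF t(1)] c v0 by (intro ennreal_plus) auto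
    ultimately show ?thesis by (simp only: add.assoc add.left_commute)
  qed
  finally show ?thesis unfolding \<Delta>_def .
qed

text \<open>Unrolling the recursion accumulates a factor of at most \<open>(1 + 1 / T) ^ T\<close>,
  hence at most \<open>exp 1\<close>. Since increments are nonnegative, the sum may be extended to
  all steps, which makes the bound uniform in \<open>t\<close>.\<close>

lemma nn_integral_distance:
  assumes i: "i < n" and t: "t \<in> {1..T}"
  shows "(\<integral>\<^sup>+x. ennreal ((norm (iter (fst x) t - iter (fst (swap i x)) t))\<^sup>2) \<partial>(\<Omega> \<Otimes>\<^sub>M \<rho>))
    \<le> ennreal (exp 1 * (\<Sum>s=1..T. increment i s))"
proof -
  let ?q = "1 + 1 / real T"
  have q: "?q \<ge> 1" by simp
  have "(\<integral>\<^sup>+x. ennreal ((norm (iter (fst x) (Suc m) - iter (fst (swap i x)) (Suc m)))\<^sup>2) \<partial>(\<Omega> \<Otimes>\<^sub>M \<rho>))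
    \<le> ennreal (?q ^ m * (\<Sum>s=1..m. increment i s))" if "Suc m \<le> T" for m
    using that
  proof (induction m)
    \<comment> \<open>The iterates start at index 1, where both runs are at 0; hence the shift by
      one, a base case with distance 0, and an empty sum.\<close>
    case 0
    then show ?case by simp
  next
    case (Suc m)
    have nn: "0 \<le> (\<Sum>s=1..m. increment i s)"
      using Suc.prems by (intro sum_nonneg increment_nonneg i) auto
    have nn': "0 \<le> increment i (Suc m)"
      using Suc.prems by (intro increment_nonneg i) auto
    have "(\<integral>\<^sup>+x. ennreal ((norm (iter (fst x) (Suc (Suc m)) - iter (fst (swap i x)) (Suc (Suc m))))\<^sup>2) \<partial>(\<Omega> \<Otimes>\<^sub>M \<rho>))
      \<le> ennreal ?q * ennreal (?q ^ m * (\<Sum>s=1..m. increment i s)) + ennreal (increment i (Suc m))"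
      using Suc.IH Suc.prems
      by (intro order_trans[OF nn_integral_distance_step[OF i, of "Suc m"]] add_right_mono mult_left_mono) simp_all
    also have "\<dots> = ennreal (?q ^ Suc m * (\<Sum>s=1..m. increment i s) + increment i (Suc m))"
      using nn nn' by (subst ennreal_mult[symmetric]) (auto simp: ennreal_plus[symmetric] mult.assoc simp del: ennreal_plus)
    also have "\<dots> \<le> ennreal (?q ^ Suc m * (\<Sum>s=1..Suc m. increment i s))"
      using mult_right_mono[OF one_le_power[OF q, of "Suc m"] nn']
      by (intro ennreal_leI) (simp add: algebra_simps)
    finally show ?case .
  qed
  from this[of "t - 1"] t
  have "(\<integral>\<^sup>+x. ennreal ((norm (iter (fst x) t - iter (fst (swap i x)) t))\<^sup>2) \<partial>(\<Omega> \<Otimes>\<^sub>M \<rho>))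
    \<le> ennreal (?q ^ (t - 1) * (\<Sum>s=1..t - 1. increment i s))" by simp
  also have "\<dots> \<le> ennreal (exp 1 * (\<Sum>s=1..T. increment i s))"
  proof (intro ennreal_leI mult_mono)
    have "?q ^ (t - 1) \<le> ?q ^ T" using t by (intro power_increasing) auto
    also have "\<dots> \<le> exp 1" using exp_ge_one_plus_x_over_n_power_n[of T 1] T by simp
    finally show "?q ^ (t - 1) \<le> exp 1" .
    show "(\<Sum>s=1..t - 1. increment i s) \<le> (\<Sum>s=1..T. increment i s)"
      using t increment_nonneg[OF i] by (intro sum_mono2) auto
    show "0 \<le> (\<Sum>s=1..t - 1. increment i s)"
      using t by (intro sum_nonneg increment_nonneg[OF i]) auto
  qed simp
  finally show ?thesis .
qed

text \<open>Averaging over the exchanged position turns losses at single examples into an empirical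
  mean, the form in which the risk enters the final bounds.\<close>

lemma mean_increment:
  "(\<Sum>i<n. exp 1 * (\<Sum>t=1..T. increment i t)) / real n
    = exp 1 * ((\<Sum>t=1..T. a t) + 4 * (1 + real T / real n) * K / real n *
        (\<Sum>t=1..T. (\<eta> t)\<^sup>2 * ((\<Sum>i<n. \<integral>\<omega>. U (iter \<omega> t) (fst \<omega> i) \<partial>\<Omega>) / real n)))"
proof -
  define c where "c = 4 * (1 + real T / real n) * K / real n"
  define v where "v i t = (\<integral>\<omega>. U (iter \<omega> t) (fst \<omega> i) \<partial>\<Omega>)" for i t
  have inc: "increment i t = a t + c * ((\<eta> t)\<^sup>2 * v i t)" for i t
    by (simp add: increment_def c_def v_def)
  have "(\<Sum>i<n. \<Sum>t=1..T. increment i t) / real n = (\<Sum>t=1..T. (\<Sum>i<n. increment i t) / real n)"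
    by (subst sum.swap) (simp add: sum_divide_distrib)
  also have "\<dots> = (\<Sum>t=1..T. a t + c * ((\<eta> t)\<^sup>2 * ((\<Sum>i<n. v i t) / real n)))"
    using n unfolding inc by (intro sum.cong refl) (simp add: sum.distrib sum_distrib_left add_divide_distrib)
  also have "\<dots> = (\<Sum>t=1..T. a t) + c * (\<Sum>t=1..T. (\<eta> t)\<^sup>2 * ((\<Sum>i<n. v i t) / real n))"
    by (simp add: sum.distrib sum_distrib_left)
  finally show ?thesis
    unfolding sum_distrib_left[symmetric] c_def[symmetric] v_def[symmetric] times_divide_eq_right[symmetric, of "exp 1"]
    by (rule arg_cong)
qed

text \<open>The squared norm is convex, so averaging the iterates preserves a bound that is the same
  for all of them. Integrability is a consequence: the nonnegative integral turns out to be
  finite.\<close>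

lemma avg_stability:
  assumes i: "i < n"
  shows "integrable (\<Omega> \<Otimes>\<^sub>M \<rho>) (\<lambda>x. (norm (avg (fst (swap i x)) - avg (fst x)))\<^sup>2)"
    and "(\<integral>x. (norm (avg (fst (swap i x)) - avg (fst x)))\<^sup>2 \<partial>(\<Omega> \<Otimes>\<^sub>M \<rho>))
      \<le> exp 1 * (\<Sum>s=1..T. increment i s)"
proof -
  let ?E = "\<Omega> \<Otimes>\<^sub>M \<rho>"
  let ?d = "\<lambda>x t. iter (fst x) t - iter (fst (swap i x)) t"
  have nn: "0 \<le> exp 1 * (\<Sum>s=1..T. increment i s)"
    using increment_nonneg[OF i] by (intro mult_nonneg_nonneg sum_nonneg) auto
  have convex: "(norm (avg (fst (swap i x)) - avg (fst x)))\<^sup>2 \<le> (\<Sum>t=1..T. 1 / real T * (norm (?d x t))\<^sup>2)" for x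
  proof -
    have "avg (fst x) - avg (fst (swap i x)) = (1 / real T) *\<^sub>R (\<Sum>t=1..T. ?d x t)"
      by (simp add: avg_def sum_subtractf scaleR_diff_right)
    then have "norm (avg (fst (swap i x)) - avg (fst x)) = 1 / real T * norm (\<Sum>t=1..T. ?d x t)"
      by (subst norm_minus_commute) simp
    also have "\<dots> \<le> 1 / real T * (\<Sum>t=1..T. norm (?d x t))"
      by (intro mult_left_mono norm_sum) simp
    finally have "(norm (avg (fst (swap i x)) - avg (fst x)))\<^sup>2 \<le> (1 / real T * (\<Sum>t=1..T. norm (?d x t)))\<^sup>2"
      by (intro power_mono) auto
    also have "\<dots> \<le> (1 / real T)\<^sup>2 * ((\<Sum>t=1..T. (norm (?d x t))\<^sup>2) * real T)"
      unfolding power_mult_distrib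
      using sum_squared_le_sum_of_squares[of "\<lambda>t. norm (?d x t)" "{1..T}"] by (intro mult_left_mono) auto
    also have "\<dots> = (\<Sum>t=1..T. 1 / real T * (norm (?d x t))\<^sup>2)"
      unfolding sum_distrib_left[symmetric] using T by (simp add: power2_eq_square)
    finally show ?thesis .
  qed
  have meas [measurable]: "(\<lambda>x. (norm (avg (fst (swap i x)) - avg (fst x)))\<^sup>2) \<in> borel_measurable ?E"
  proof -
    have [measurable]: "(\<lambda>x. avg (fst (swap i x))) \<in> borel_measurable ?E"
      using measurable_compose[OF measurable_swap[OF i], of "\<lambda>x. avg (fst x)" borel] by simp
    show ?thesis by measurable
  qed
  have "(\<integral>\<^sup>+x. ennreal ((norm (avg (fst (swap i x)) - avg (fst x)))\<^sup>2) \<partial>?E)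
      \<le> (\<integral>\<^sup>+x. (\<Sum>t=1..T. ennreal (1 / real T) * ennreal ((norm (?d x t))\<^sup>2)) \<partial>?E)"
    using ennreal_leI[OF convex]
    by (intro nn_integral_mono) (simp add: ennreal_mult[symmetric] sum_ennreal)
  also have "\<dots> = (\<Sum>t=1..T. ennreal (1 / real T) * (\<integral>\<^sup>+x. ennreal ((norm (?d x t))\<^sup>2) \<partial>?E))"
    using measurable_distance[OF i]
    by (subst nn_integral_sum) (auto intro!: sum.cong nn_integral_cmult borel_measurable_times)
  also have "\<dots> \<le> (\<Sum>t=1..T. ennreal (1 / real T) * ennreal (exp 1 * (\<Sum>s=1..T. increment i s)))"
    by (intro sum_mono mult_left_mono nn_integral_distance i) auto
  also have "\<dots> = ennreal (exp 1 * (\<Sum>s=1..T. increment i s))"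
  proof -
    have "(\<Sum>t=1..T. ennreal (1 / real T) * ennreal (exp 1 * (\<Sum>s=1..T. increment i s)))
        = ennreal (\<Sum>t=1..T. 1 / real T * (exp 1 * (\<Sum>s=1..T. increment i s)))"
      using nn by (subst sum_ennreal[symmetric]) (simp_all only: ennreal_mult' zero_le_divide_1_iff of_nat_0_le_iff mult_nonneg_nonneg)
    then show ?thesis using T by simp
  qed
  finally have *: "(\<integral>\<^sup>+x. ennreal ((norm (avg (fst (swap i x)) - avg (fst x)))\<^sup>2) \<partial>?E)
      \<le> ennreal (exp 1 * (\<Sum>s=1..T. increment i s))" .
  show "integrable ?E (\<lambda>x. (norm (avg (fst (swap i x)) - avg (fst x)))\<^sup>2)"
    using le_less_trans[OF * ennreal_less_top] by (intro integrableI_nonneg meas) auto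
  show "(\<integral>x. (norm (avg (fst (swap i x)) - avg (fst x)))\<^sup>2 \<partial>?E) \<le> exp 1 * (\<Sum>s=1..T. increment i s)"
    using * nn by (intro integral_real_bounded) auto
qed

end

section \<open>From stability to the generalization gap\<close>

lemma emp_risk_nonneg:
  assumes "\<And>w z. z \<in> space \<rho> \<Longrightarrow> 0 \<le> f w z" "\<omega> \<in> space \<Omega>"
  shows "0 \<le> emp_risk n f (fst \<omega>) w"
  unfolding emp_risk_def using assms by (auto intro!: divide_nonneg_nonneg sum_nonneg sample_in_space)

text \<open>A single nonnegative loss is at most \<open>n\<close> times the empirical risk, so it
  inherits integrability from the latter.\<close>

lemma integrable_sample_loss:
  fixes f :: "'w \<Rightarrow> 'z \<Rightarrow> real"
  assumes f_meas: "(\<lambda>(w, z). f w z) \<in> borel_measurable (borel \<Otimes>\<^sub>M \<rho>)"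
    and f_nonneg: "\<And>w z. z \<in> space \<rho> \<Longrightarrow> 0 \<le> f w z"
    and A [measurable]: "A \<in> borel_measurable \<Omega>"
    and int: "integrable \<Omega> (\<lambda>\<omega>. emp_risk n f (fst \<omega>) (A \<omega>))"
    and i: "i < n"
  shows "integrable \<Omega> (\<lambda>\<omega>. f (A \<omega>) (fst \<omega> i))"
proof (rule Bochner_Integration.integrable_bound)
  show "integrable \<Omega> (\<lambda>\<omega>. real n * emp_risk n f (fst \<omega>) (A \<omega>))" using int by simp
  show "(\<lambda>\<omega>. f (A \<omega>) (fst \<omega> i)) \<in> borel_measurable \<Omega>"
    by (rule measurable_pair_fun[OF f_meas A measurable_sample[OF i]])
  show "AE \<omega> in \<Omega>. norm (f (A \<omega>) (fst \<omega> i)) \<le> norm (real n * emp_risk n f (fst \<omega>) (A \<omega>))"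
  proof (rule AE_I2)
    fix \<omega> assume \<omega>: "\<omega> \<in> space \<Omega>"
    have "f (A \<omega>) (fst \<omega> i) \<le> (\<Sum>j<n. f (A \<omega>) (fst \<omega> j))"
      using i \<omega> by (intro member_le_sum f_nonneg sample_in_space) auto
    also have "\<dots> = real n * emp_risk n f (fst \<omega>) (A \<omega>)" using n by (simp add: emp_risk_def)
    finally show "norm (f (A \<omega>) (fst \<omega> i)) \<le> norm (real n * emp_risk n f (fst \<omega>) (A \<omega>))"
      using f_nonneg[OF sample_in_space[OF \<omega> i], of "A \<omega>"] by simp
  qed
qed

text \<open>As \<open>f\<close> is nonnegative, the inner integral of its norm is the population
  risk, so integrability of that risk along the run yields joint integrability with the ghost
  example.\<close>

lemma
  fixes f :: "'w \<Rightarrow> 'z \<Rightarrow> real"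
  assumes f_meas: "(\<lambda>(w, z). f w z) \<in> borel_measurable (borel \<Otimes>\<^sub>M \<rho>)"
    and f_nonneg: "\<And>w z. z \<in> space \<rho> \<Longrightarrow> 0 \<le> f w z"
    and F_int: "\<And>w. integrable \<rho> (f w)"
    and int: "integrable \<Omega> (\<lambda>\<omega>. pop_risk \<rho> f (avg \<omega>))"
  shows integrable_ghost_loss: "integrable (\<Omega> \<Otimes>\<^sub>M \<rho>) (\<lambda>x. f (avg (fst x)) (snd x))"
    and integral_ghost_loss:
      "(\<integral>x. f (avg (fst x)) (snd x) \<partial>(\<Omega> \<Otimes>\<^sub>M \<rho>)) = (\<integral>\<omega>. pop_risk \<rho> f (avg \<omega>) \<partial>\<Omega>)"
proof -
  have meas: "(\<lambda>x. f (avg (fst x)) (snd x)) \<in> borel_measurable (\<Omega> \<Otimes>\<^sub>M \<rho>)"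
    by (rule measurable_pair_fun[OF f_meas]) measurable
  have "integrable \<Omega> (\<lambda>\<omega>. \<integral>z. norm (f (avg \<omega>) z) \<partial>\<rho>)"
  proof (rule Bochner_Integration.integrable_cong[THEN iffD1, OF refl _ int])
    show "pop_risk \<rho> f (avg \<omega>) = (\<integral>z. norm (f (avg \<omega>) z) \<partial>\<rho>)" for \<omega>
      unfolding pop_risk_def by (rule Bochner_Integration.integral_cong) (simp_all add: f_nonneg)
  qed
  then show I: "integrable (\<Omega> \<Otimes>\<^sub>M \<rho>) (\<lambda>x. f (avg (fst x)) (snd x))"
    by (intro ghost.Fubini_integrable meas) (simp_all add: F_int)
  show "(\<integral>x. f (avg (fst x)) (snd x) \<partial>(\<Omega> \<Otimes>\<^sub>M \<rho>)) = (\<integral>\<omega>. pop_risk \<rho> f (avg \<omega>) \<partial>\<Omega>)"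
    using ghost.integral_fst'[OF I] by (simp add: pop_risk_def)
qed

lemma integral_emp_risk:
  fixes f :: "'w \<Rightarrow> 'z \<Rightarrow> real"
  assumes "\<And>i. i < n \<Longrightarrow> integrable \<Omega> (\<lambda>\<omega>. f (A \<omega>) (fst \<omega> i))"
  shows "(\<integral>\<omega>. emp_risk n f (fst \<omega>) (A \<omega>) \<partial>\<Omega>) = (\<Sum>i<n. \<integral>\<omega>. f (A \<omega>) (fst \<omega> i) \<partial>\<Omega>) / real n"
  unfolding emp_risk_def using assms by (subst Bochner_Integration.integral_sum[symmetric]) auto

text \<open>After the exchange, the loss of the perturbed output on the \<^term>\<open>i\<close>-th sample has the law of the
  loss of the output on a fresh example; hence the gap is an average of loss differences.\<close>

lemma generalization_gap_le:
  fixes f :: "'w \<Rightarrow> 'z \<Rightarrow> real"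
  assumes f_meas: "(\<lambda>(w, z). f w z) \<in> borel_measurable (borel \<Otimes>\<^sub>M \<rho>)"
    and f_nonneg: "\<And>w z. z \<in> space \<rho> \<Longrightarrow> 0 \<le> f w z"
    and F_int: "\<And>w. integrable \<rho> (f w)"
    and int_F: "integrable \<Omega> (\<lambda>\<omega>. pop_risk \<rho> f (avg \<omega>))"
    and int_FS: "integrable \<Omega> (\<lambda>\<omega>. emp_risk n f (fst \<omega>) (avg \<omega>))"
    and P_int: "\<And>i. i < n \<Longrightarrow> integrable (\<Omega> \<Otimes>\<^sub>M \<rho>) (P i)"
    and diff: "\<And>i x. i < n \<Longrightarrow> x \<in> space (\<Omega> \<Otimes>\<^sub>M \<rho>) \<Longrightarrow>
      f (avg (fst (swap i x))) (fst (fst x) i) - f (avg (fst x)) (fst (fst x) i)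
        \<le> P i x + \<kappa> * (norm (avg (fst (swap i x)) - avg (fst x)))\<^sup>2"
    and stab_int: "\<And>i. i < n \<Longrightarrow>
      integrable (\<Omega> \<Otimes>\<^sub>M \<rho>) (\<lambda>x. (norm (avg (fst (swap i x)) - avg (fst x)))\<^sup>2)"
    and stab: "\<And>i. i < n \<Longrightarrow>
      (\<integral>x. (norm (avg (fst (swap i x)) - avg (fst x)))\<^sup>2 \<partial>(\<Omega> \<Otimes>\<^sub>M \<rho>)) \<le> D i"
    and \<kappa>: "\<kappa> \<ge> 0"
  shows "(\<integral>\<omega>. pop_risk \<rho> f (avg \<omega>) - emp_risk n f (fst \<omega>) (avg \<omega>) \<partial>\<Omega>)
    \<le> (\<Sum>i<n. \<integral>x. P i x \<partial>(\<Omega> \<Otimes>\<^sub>M \<rho>)) / real n + \<kappa> * ((\<Sum>i<n. D i) / real n)"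
proof -
  let ?E = "\<Omega> \<Otimes>\<^sub>M \<rho>"
  let ?F = "\<integral>\<omega>. pop_risk \<rho> f (avg \<omega>) \<partial>\<Omega>"
  have ghost: "integrable ?E (\<lambda>x. f (avg (fst x)) (snd x))"
    by (rule integrable_ghost_loss[OF f_meas _ F_int int_F]) (rule f_nonneg)
  have ghost_eq: "(\<integral>x. f (avg (fst x)) (snd x) \<partial>?E) = ?F"
    by (rule integral_ghost_loss[OF f_meas _ F_int int_F]) (rule f_nonneg)
  have sample: "integrable \<Omega> (\<lambda>\<omega>. f (avg \<omega>) (fst \<omega> i))" if "i < n" for i
    by (rule integrable_sample_loss[OF f_meas _ measurable_avg int_FS that]) (rule f_nonneg)
  have gap: "?F - (\<integral>\<omega>. f (avg \<omega>) (fst \<omega> i) \<partial>\<Omega>) \<le> (\<integral>x. P i x \<partial>?E) + \<kappa> * D i" if i: "i < n" for i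
  proof -
    \<comment> \<open>The \<open>i\<close>-th sample is the ghost coordinate of
      \<open>swap i x\<close>, so invariance of the law reduces this loss to that of a run tested on
      a fresh example.\<close>
    have swapped: "(\<lambda>x. f (avg (fst (swap i x))) (fst (fst x) i)) = (\<lambda>x. f (avg (fst (swap i x))) (snd (swap i x)))"
      by (simp add: swap_def)
    have int1: "integrable ?E (\<lambda>x. f (avg (fst (swap i x))) (fst (fst x) i))"
      unfolding swapped by (rule integrable_swap[OF i ghost])
    have int2: "integrable ?E (\<lambda>x. f (avg (fst x)) (fst (fst x) i))"
      by (rule integrable_Om[OF sample[OF i]])
    have "(\<integral>x. f (avg (fst (swap i x))) (fst (fst x) i) \<partial>?E) = ?F"
      unfolding swapped
      using integral_swap[OF i borel_measurable_integrable[OF ghost]] ghost_eq by simp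
    moreover have "(\<integral>x. f (avg (fst x)) (fst (fst x) i) \<partial>?E) = (\<integral>\<omega>. f (avg \<omega>) (fst \<omega> i) \<partial>\<Omega>)"
      by (rule integral_Om[OF borel_measurable_integrable[OF sample[OF i]]])
    ultimately have "?F - (\<integral>\<omega>. f (avg \<omega>) (fst \<omega> i) \<partial>\<Omega>)
        = (\<integral>x. f (avg (fst (swap i x))) (fst (fst x) i) - f (avg (fst x)) (fst (fst x) i) \<partial>?E)"
      using int1 int2 by simp
    also have "\<dots> \<le> (\<integral>x. P i x + \<kappa> * (norm (avg (fst (swap i x)) - avg (fst x)))\<^sup>2 \<partial>?E)"
      using int1 int2 P_int[OF i] stab_int[OF i] diff[OF i] by (intro integral_mono) auto
    also have "\<dots> = (\<integral>x. P i x \<partial>?E) + \<kappa> * (\<integral>x. (norm (avg (fst (swap i x)) - avg (fst x)))\<^sup>2 \<partial>?E)"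
      using P_int[OF i] stab_int[OF i] by simp
    also have "\<dots> \<le> (\<integral>x. P i x \<partial>?E) + \<kappa> * D i"
      using stab[OF i] \<kappa> by (intro add_left_mono mult_left_mono) auto
    finally show ?thesis .
  qed
  have "(\<integral>\<omega>. pop_risk \<rho> f (avg \<omega>) - emp_risk n f (fst \<omega>) (avg \<omega>) \<partial>\<Omega>)
      = ?F - (\<Sum>i<n. \<integral>\<omega>. f (avg \<omega>) (fst \<omega> i) \<partial>\<Omega>) / real n"
    using int_F int_FS sample by (simp add: integral_emp_risk)
  also have "\<dots> = (\<Sum>i<n. ?F - (\<integral>\<omega>. f (avg \<omega>) (fst \<omega> i) \<partial>\<Omega>)) / real n"
    using n by (simp add: sum_subtractf field_simps)
  also have "\<dots> \<le> (\<Sum>i<n. (\<integral>x. P i x \<partial>?E) + \<kappa> * D i) / real n"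
    using gap by (intro divide_right_mono sum_mono) auto
  also have "\<dots> = (\<Sum>i<n. \<integral>x. P i x \<partial>?E) / real n + \<kappa> * ((\<Sum>i<n. D i) / real n)"
    by (simp add: sum.distrib add_divide_distrib sum_distrib_left)
  finally show ?thesis .
qed

section \<open>Almost sure agreement with the original iterates, and Jensen for the risks\<close>

lemma AE_idx: "AE \<omega> in \<Omega>. \<forall>t\<in>{1..T}. idx \<omega> t = fst (snd \<omega>) t"
proof -
  have "AE I in indices. \<forall>t\<in>{1..T}. I t < n"
  proof (rule AE_ball_countable'[OF _ countable_finite])
    fix t assume t: "t \<in> {1..T}"
    have "AE k in measure_pmf (pmf_of_set {..<n}). k < n"
      using n by (intro AE_pmfI) (auto simp: lessThan_empty_iff)
    from AE_PiM_component[OF prob_space_measure_pmf t this]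
    show "AE I in indices. I t < n" unfolding indices_def .
  qed simp
  then have "AE S in samples. AE I in indices. AE B in noises. \<forall>t\<in>{1..T}. I t < n"
    by simp
  then have "AE S in samples. AE r in indices \<Otimes>\<^sub>M noises. \<forall>t\<in>{1..T}. fst r t < n"
    by eventually_elim (rule IN.AE_pair_measure, unfold indices_def, measurable)
  then have "AE \<omega> in \<Omega>. \<forall>t\<in>{1..T}. fst (snd \<omega>) t < n"
    unfolding \<Omega>_def by (intro \<Omega>.AE_pair_measure) (unfold indices_def, measurable)
  then show ?thesis by eventually_elim (simp add: idx_def)
qed

lemma iterate_w_eq_iter:
  assumes "\<forall>t\<in>{1..T}. idx \<omega> t = fst (snd \<omega>) t" "t \<le> T"
  shows "iterate_w g \<eta> \<omega> t = iter \<omega> t"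
  using assms(2) by (induction t) (use assms(1) in \<open>auto simp: iterate_w_def iter_def\<close>)

lemma AE_iterate_w:
  "AE \<omega> in \<Omega>. (\<forall>t\<in>{1..T}. iterate_w g \<eta> \<omega> t = iter \<omega> t) \<and> w_priv g \<eta> T \<omega> = avg \<omega>"
  using AE_idx by eventually_elim (auto simp: iterate_w_eq_iter w_priv_def avg_def)

lemma measurable_pop_risk [measurable]:
  fixes f :: "'w \<Rightarrow> 'z \<Rightarrow> real"
  assumes "(\<lambda>(w, z). f w z) \<in> borel_measurable (borel \<Otimes>\<^sub>M \<rho>)"
  shows "pop_risk \<rho> f \<in> borel_measurable borel"
  unfolding pop_risk_def[abs_def] using assms by (rule rho.borel_measurable_lebesgue_integral)

lemma measurable_emp_risk:
  fixes f :: "'w \<Rightarrow> 'z \<Rightarrow> real"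
  assumes "(\<lambda>(w, z). f w z) \<in> borel_measurable (borel \<Otimes>\<^sub>M \<rho>)" "A \<in> borel_measurable \<Omega>"
  shows "(\<lambda>\<omega>. emp_risk n f (fst \<omega>) (A \<omega>)) \<in> borel_measurable \<Omega>"
  unfolding emp_risk_def
  by (intro borel_measurable_divide borel_measurable_sum measurable_pair_fun[OF assms] measurable_sample) auto

lemma pop_risk_nonneg:
  "(\<And>w z. z \<in> space \<rho> \<Longrightarrow> 0 \<le> f w z) \<Longrightarrow> 0 \<le> pop_risk \<rho> f w"
  unfolding pop_risk_def by (rule Bochner_Integration.integral_nonneg)

text \<open>For the perturbed output the \<open>i\<close>-th sample behaves like a fresh example
  \<open>z\<close>. Jensen is applied to the integral over \<open>z\<close> with the run held fixed,
  so the power ends up on the population risk but stays inside the expectation over runs.\<close>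

lemma
  fixes f :: "'w \<Rightarrow> 'z \<Rightarrow> real"
  assumes f_meas: "(\<lambda>(w, z). f w z) \<in> borel_measurable (borel \<Otimes>\<^sub>M \<rho>)"
    and f_nonneg: "\<And>w z. z \<in> space \<rho> \<Longrightarrow> 0 \<le> f w z"
    and F_int: "\<And>w. integrable \<rho> (f w)"
    and int: "integrable \<Omega> (\<lambda>\<omega>. pop_risk \<rho> f (avg \<omega>))"
    and i: "i < n" and q: "0 \<le> q" "q \<le> 1"
  shows integrable_swapped_nnpow:
      "integrable (\<Omega> \<Otimes>\<^sub>M \<rho>) (\<lambda>x. nnpow (f (avg (fst (swap i x))) (fst (fst x) i)) q)"
    and integral_swapped_nnpow_le:
      "(\<integral>x. nnpow (f (avg (fst (swap i x))) (fst (fst x) i)) q \<partial>(\<Omega> \<Otimes>\<^sub>M \<rho>))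
        \<le> (\<integral>\<omega>. nnpow (pop_risk \<rho> f (avg \<omega>)) q \<partial>\<Omega>)"
proof -
  let ?h = "\<lambda>x. nnpow (f (avg (fst x)) (snd x)) q"
  have swapped: "(\<lambda>x. nnpow (f (avg (fst (swap i x))) (fst (fst x) i)) q) = (\<lambda>x. ?h (swap i x))"
    by (simp add: swap_def)
  have I: "integrable (\<Omega> \<Otimes>\<^sub>M \<rho>) ?h"
  proof (rule integrable_nnpow[OF _ _ _ q])
    show "finite_measure (\<Omega> \<Otimes>\<^sub>M \<rho>)" by (rule ghost.finite_measure_axioms)
    show "integrable (\<Omega> \<Otimes>\<^sub>M \<rho>) (\<lambda>x. f (avg (fst x)) (snd x))"
      by (rule integrable_ghost_loss[OF f_meas _ F_int int]) (rule f_nonneg)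
    show "AE x in \<Omega> \<Otimes>\<^sub>M \<rho>. 0 \<le> f (avg (fst x)) (snd x)"
      by (intro AE_I2 f_nonneg) (auto simp: space_pair_measure)
  qed
  then show "integrable (\<Omega> \<Otimes>\<^sub>M \<rho>) (\<lambda>x. nnpow (f (avg (fst (swap i x))) (fst (fst x) i)) q)"
    unfolding swapped by (rule integrable_swap[OF i])
  have "(\<integral>x. ?h (swap i x) \<partial>(\<Omega> \<Otimes>\<^sub>M \<rho>)) = (\<integral>x. ?h x \<partial>(\<Omega> \<Otimes>\<^sub>M \<rho>))"
    by (rule integral_swap[OF i borel_measurable_integrable[OF I]])
  also have "\<dots> = (\<integral>\<omega>. (\<integral>z. nnpow (f (avg \<omega>) z) q \<partial>\<rho>) \<partial>\<Omega>)"
    using ghost.integral_fst'[OF I] by simp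
  also have "\<dots> \<le> (\<integral>\<omega>. nnpow (pop_risk \<rho> f (avg \<omega>)) q \<partial>\<Omega>)"
  proof (rule integral_mono)
    show "integrable \<Omega> (\<lambda>\<omega>. \<integral>z. nnpow (f (avg \<omega>) z) q \<partial>\<rho>)"
      using ghost.integrable_fst'[OF I] by simp
    show "integrable \<Omega> (\<lambda>\<omega>. nnpow (pop_risk \<rho> f (avg \<omega>)) q)"
      using int q by (intro integrable_nnpow AE_I2 pop_risk_nonneg f_nonneg) unfold_locales
    show "(\<integral>z. nnpow (f (avg \<omega>) z) q \<partial>\<rho>) \<le> nnpow (pop_risk \<rho> f (avg \<omega>)) q" for \<omega>
      unfolding pop_risk_def using q by (intro rho.jensen_nnpow F_int AE_I2 f_nonneg)
  qed
  finally show "(\<integral>x. nnpow (f (avg (fst (swap i x))) (fst (fst x) i)) q \<partial>(\<Omega> \<Otimes>\<^sub>M \<rho>))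
        \<le> (\<integral>\<omega>. nnpow (pop_risk \<rho> f (avg \<omega>)) q \<partial>\<Omega>)"
    unfolding swapped .
qed

text \<open>Jensen over a uniform position in the sample, pointwise in \<omega>, turns powers of
  single losses into a power of the empirical risk.\<close>

lemma mean_sample_nnpow_le:
  fixes f :: "'w \<Rightarrow> 'z \<Rightarrow> real"
  assumes f_nonneg: "\<And>w z. z \<in> space \<rho> \<Longrightarrow> 0 \<le> f w z"
    and sample: "\<And>i. i < n \<Longrightarrow> integrable \<Omega> (\<lambda>\<omega>. nnpow (f (A \<omega>) (fst \<omega> i)) q)"
    and emp: "integrable \<Omega> (\<lambda>\<omega>. emp_risk n f (fst \<omega>) (A \<omega>))"
    and q: "0 \<le> q" "q \<le> 1"
  shows "(\<Sum>i<n. \<integral>\<omega>. nnpow (f (A \<omega>) (fst \<omega> i)) q \<partial>\<Omega>) / real n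
    \<le> (\<integral>\<omega>. nnpow (emp_risk n f (fst \<omega>) (A \<omega>)) q \<partial>\<Omega>)"
proof -
  have "(\<Sum>i<n. \<integral>\<omega>. nnpow (f (A \<omega>) (fst \<omega> i)) q \<partial>\<Omega>) / real n
      = (\<integral>\<omega>. (\<Sum>i<n. nnpow (f (A \<omega>) (fst \<omega> i)) q) / real n \<partial>\<Omega>)"
    using sample by (subst Bochner_Integration.integral_sum[symmetric]) auto
  also have "\<dots> \<le> (\<integral>\<omega>. nnpow (emp_risk n f (fst \<omega>) (A \<omega>)) q \<partial>\<Omega>)"
  proof (rule integral_mono)
    show "integrable \<Omega> (\<lambda>\<omega>. (\<Sum>i<n. nnpow (f (A \<omega>) (fst \<omega> i)) q) / real n)"
      using sample by (intro integrable_divide Bochner_Integration.integrable_sum) simp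
    show "integrable \<Omega> (\<lambda>\<omega>. nnpow (emp_risk n f (fst \<omega>) (A \<omega>)) q)"
      using emp q by (intro integrable_nnpow AE_I2 emp_risk_nonneg f_nonneg) unfold_locales
    show "(\<Sum>i<n. nnpow (f (A \<omega>) (fst \<omega> i)) q) / real n \<le> nnpow (emp_risk n f (fst \<omega>) (A \<omega>)) q"
      if "\<omega> \<in> space \<Omega>" for \<omega>
      unfolding emp_risk_def using n q that
      by (intro mean_nnpow_le f_nonneg sample_in_space)
  qed
  finally show ?thesis .
qed

end

section \<open>The Gaussian noise law and Young's inequality\<close>

lemma sets_gauss_vec: "sets (gauss_vec s2) = sets borel"
  by (simp add: gauss_vec_def)

lemma prob_space_gauss_vec:
  assumes "s2 > 0"
  shows "prob_space (gauss_vec s2 :: (real^'d) measure)"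
proof -
  let ?M = "PiM UNIV (\<lambda>_::'d. density lborel (normal_density 0 (sqrt s2)))"
  interpret prob_space ?M
    using assms by (intro prob_space_PiM prob_space_normal_density) simp
  have "(\<lambda>x. \<chi> i. x i) \<in> measurable ?M (borel :: (real^'d) measure)"
  proof (rule borel_measurable_euclidean_space[THEN iffD2, rule_format])
    fix b :: "real^'d" assume "b \<in> Basis"
    then obtain i where b: "b = axis i 1" by (auto simp: Basis_vec_def)
    have "(\<lambda>x. x i) \<in> measurable ?M (density lborel (normal_density 0 (sqrt s2)))"
      by measurable
    then have "(\<lambda>x. x i) \<in> borel_measurable ?M"
      by (subst (asm) measurable_cong_sets[OF refl, of _ borel]) simp_all
    then show "(\<lambda>x. (\<chi> i. x i) \<bullet> b) \<in> borel_measurable ?M"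
      by (simp add: b inner_axis)
  qed
  then show ?thesis unfolding gauss_vec_def by (rule prob_space_distr)
qed

text \<open>Strict positivity makes the normal density a probability density, and thus
  \<open>gauss_vec\<close> an admissible choice of \<open>N\<close>.\<close>

lemma dp_sigma2_pos:
  assumes "G > 0" "\<epsilon> > 0" "0 < \<delta>" "\<delta> < 1" "0 < \<beta>" "\<beta> < 1" "n \<ge> 1" "T \<ge> 1"
  shows "dp_sigma2 G \<epsilon> \<delta> \<beta> T n > 0"
proof -
  have "ln (1 / \<delta>) > 0" using assms by (intro ln_gt_zero) simp
  then show ?thesis unfolding dp_sigma2_def using assms
    by (intro mult_pos_pos divide_pos_pos add_pos_pos) auto
qed

lemma inner_le_young:
  fixes x y :: "'a::real_inner"
  assumes "\<gamma> > 0"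
  shows "inner x y \<le> (norm x)\<^sup>2 / (2 * \<gamma>) + \<gamma> / 2 * (norm y)\<^sup>2"
proof -
  have "0 \<le> (norm x - \<gamma> * norm y)\<^sup>2 / (2 * \<gamma>)" using assms by simp
  also have "\<dots> = (norm x)\<^sup>2 / (2 * \<gamma>) + \<gamma> / 2 * (norm y)\<^sup>2 - norm x * norm y"
    using assms by (simp add: field_simps power2_eq_square)
  finally show ?thesis using norm_cauchy_schwarz[of x y] by linarith
qed

section \<open>The two bounds under an abstract noise law\<close>

context noisy_sgd
begin

text \<open>Smoothness leaves the remainder coefficient \<open>L / 2\<close>, Young's inequality
  adds \<open>\<gamma> / 2\<close>, and self-bounding converts the gradient term into
  \<open>L / \<gamma>\<close> times the loss. The product of \<open>(L + \<gamma>) / 2\<close> with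
  \<open>K = 2 * L\<close> is the factor \<open>(L + \<gamma>) * L\<close> of the second
  term.\<close>

theorem smooth_generalization_gap:
  fixes f :: "'w \<Rightarrow> 'z \<Rightarrow> real"
  assumes f_meas: "(\<lambda>(w, z). f w z) \<in> borel_measurable (borel \<Otimes>\<^sub>M \<rho>)"
    and nonneg: "\<And>w z. z \<in> space \<rho> \<Longrightarrow> 0 \<le> f w z"
    and F_int: "\<And>w. integrable \<rho> (f w)"
    and int_F: "integrable \<Omega> (\<lambda>\<omega>. pop_risk \<rho> f (avg \<omega>))"
    and int_FS: "integrable \<Omega> (\<lambda>\<omega>. emp_risk n f (fst \<omega>) (avg \<omega>))"
    and int_FS_t: "\<And>t. t \<in> {1..T} \<Longrightarrow> integrable \<Omega> (\<lambda>\<omega>. emp_risk n f (fst \<omega>) (iter \<omega> t))"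
    and sub: "is_subgradient f g (space \<rho>)"
    and smooth: "l_smooth L f g (space \<rho>)"
    and \<eta>: "\<And>t. t \<in> {1..T} \<Longrightarrow> 0 < \<eta> t" "\<And>t. t \<in> {1..T} \<Longrightarrow> \<eta> t \<le> 2 / L"
    and \<gamma>: "\<gamma> > 0"
  shows "(\<integral>\<omega>. pop_risk \<rho> f (avg \<omega>) - emp_risk n f (fst \<omega>) (avg \<omega>) \<partial>\<Omega>)
    \<le> L / \<gamma> * (\<integral>\<omega>. emp_risk n f (fst \<omega>) (avg \<omega>) \<partial>\<Omega>)
      + 4 * exp 1 * (L + \<gamma>) * (1 + real T / real n) * L / real n
        * (\<Sum>t=1..T. (\<eta> t)\<^sup>2 * (\<integral>\<omega>. emp_risk n f (fst \<omega>) (iter \<omega> t) \<partial>\<Omega>))"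
proof -
  \<comment> \<open>A positive step size of at most \<open>2 / L\<close>, here the first one, forces
    L > 0, also under the convention \<open>2 / 0 = 0\<close>.\<close>
  have "0 < 2 / L" using less_le_trans[OF \<eta>(1)[of 1] \<eta>(2)[of 1]] T by simp
  then have L: "L > 0" by (simp add: zero_less_divide_iff)
  have sub': "f w z + inner (g w z) (w' - w) \<le> f w' z" if "z \<in> space \<rho>" for z w w'
    using sub that by (auto simp: is_subgradient_def)
  have smooth': "f w' z \<le> f w z + inner (g w z) (w' - w) + L / 2 * (norm (w' - w))\<^sup>2"
    if "z \<in> space \<rho>" for z w w'
    using smooth that by (auto simp: l_smooth_def)
  have self: "(norm (g w z))\<^sup>2 \<le> 2 * L * f w z" if "z \<in> space \<rho>" for w z
    by (rule smooth_self_bounding[of "\<lambda>w. f w z" "\<lambda>w. g w z", OF smooth'[OF that] nonneg[OF that] L])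
  have step: "(norm ((w - \<eta> t *\<^sub>R g w z) - (w' - \<eta> t *\<^sub>R g w' z)))\<^sup>2 \<le> (norm (w - w'))\<^sup>2 + 0"
    if "t \<in> {1..T}" "z \<in> space \<rho>" for t z w w'
    using smooth_gradient_step_nonexpansive[of "\<lambda>w. f w z" "\<lambda>w. g w z" L "\<eta> t" w w',
        OF sub'[OF that(2)] smooth'[OF that(2)] L] \<eta>[OF that(1)] by simp
  have int_t: "integrable \<Omega> (\<lambda>\<omega>. f (iter \<omega> t) (fst \<omega> i))" if "t \<in> {1..T}" "i < n" for t i
    using that by (intro integrable_sample_loss f_meas nonneg int_FS_t measurable_iter) auto
  have int_avg: "integrable \<Omega> (\<lambda>\<omega>. f (avg \<omega>) (fst \<omega> i))" if "i < n" for i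
    using that by (intro integrable_sample_loss f_meas nonneg int_FS measurable_avg) auto
  note stab = avg_stability[of f "2 * L" "\<lambda>_. 0", OF f_meas nonneg _ _ step self int_t]
  have "(\<integral>\<omega>. pop_risk \<rho> f (avg \<omega>) - emp_risk n f (fst \<omega>) (avg \<omega>) \<partial>\<Omega>)
    \<le> (\<Sum>i<n. \<integral>x. L / \<gamma> * f (avg (fst x)) (fst (fst x) i) \<partial>(\<Omega> \<Otimes>\<^sub>M \<rho>)) / real n
      + (L + \<gamma>) / 2 * ((\<Sum>i<n. exp 1 * (\<Sum>t=1..T. increment f (2 * L) (\<lambda>_. 0) i t)) / real n)"
  proof (rule generalization_gap_le[OF f_meas _ F_int int_F int_FS _ _ stab])
    fix i x assume i: "i < n" and x: "x \<in> space (\<Omega> \<Otimes>\<^sub>M \<rho>)"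
    define s w w' where "s = fst (fst x) i" and "w = avg (fst x)" and "w' = avg (fst (swap i x))"
    have s: "s \<in> space \<rho>" using x i by (auto simp: s_def space_pair_measure intro!: sample_in_space)
    have "f w' s - f w s \<le> inner (g w s) (w' - w) + L / 2 * (norm (w' - w))\<^sup>2"
      using smooth'[OF s, of w' w] by simp
    also have "inner (g w s) (w' - w) \<le> (norm (g w s))\<^sup>2 / (2 * \<gamma>) + \<gamma> / 2 * (norm (w' - w))\<^sup>2"
      using \<gamma> by (rule inner_le_young)
    also have "(norm (g w s))\<^sup>2 / (2 * \<gamma>) \<le> (2 * L * f w s) / (2 * \<gamma>)"
      using self[OF s] \<gamma> by (intro divide_right_mono) auto
    finally show "f (avg (fst (swap i x))) (fst (fst x) i) - f (avg (fst x)) (fst (fst x) i)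
        \<le> L / \<gamma> * f (avg (fst x)) (fst (fst x) i) + (L + \<gamma>) / 2 * (norm (avg (fst (swap i x)) - avg (fst x)))\<^sup>2"
      by (simp add: s_def w_def w'_def add_divide_distrib distrib_right)
  qed (use L \<gamma> nonneg in \<open>auto intro!: integrable_Om int_avg\<close>)
  also have "(\<Sum>i<n. \<integral>x. L / \<gamma> * f (avg (fst x)) (fst (fst x) i) \<partial>(\<Omega> \<Otimes>\<^sub>M \<rho>)) / real n
      = L / \<gamma> * (\<integral>\<omega>. emp_risk n f (fst \<omega>) (avg \<omega>) \<partial>\<Omega>)"
  proof -
    have "(\<integral>x. L / \<gamma> * f (avg (fst x)) (fst (fst x) i) \<partial>(\<Omega> \<Otimes>\<^sub>M \<rho>)) = L / \<gamma> * (\<integral>\<omega>. f (avg \<omega>) (fst \<omega> i) \<partial>\<Omega>)"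
      if "i < n" for i
      using integral_Om[OF borel_measurable_integrable[OF int_avg[OF that]]] by simp
    then have "(\<Sum>i<n. \<integral>x. L / \<gamma> * f (avg (fst x)) (fst (fst x) i) \<partial>(\<Omega> \<Otimes>\<^sub>M \<rho>))
        = (\<Sum>i<n. L / \<gamma> * (\<integral>\<omega>. f (avg \<omega>) (fst \<omega> i) \<partial>\<Omega>))"
      by (intro sum.cong) simp_all
    then show ?thesis
      using int_avg by (simp add: integral_emp_risk sum_distrib_left)
  qed
  also have "(\<Sum>i<n. exp 1 * (\<Sum>t=1..T. increment f (2 * L) (\<lambda>_. 0) i t)) / real n
      = exp 1 * (4 * (1 + real T / real n) * (2 * L) / real n *
          (\<Sum>t=1..T. (\<eta> t)\<^sup>2 * (\<integral>\<omega>. emp_risk n f (fst \<omega>) (iter \<omega> t) \<partial>\<Omega>)))"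
    using L nonneg step self int_t
    by (subst mean_increment[OF f_meas]) (simp_all add: integral_emp_risk)
  also have "(L + \<gamma>) / 2 * (exp 1 * (4 * (1 + real T / real n) * (2 * L) / real n * Q))
      = 4 * exp 1 * (L + \<gamma>) * (1 + real T / real n) * L / real n * Q" for Q
    by simp
  finally show ?thesis .
qed

text \<open>Convexity bounds the loss difference by an inner product without remainder, so the
  distance enters only through Young's inequality, with coefficient \<open>\<gamma> / 2\<close>.
  Jensen acts twice: over the fresh example for the population risk, and over the sample position
  for the empirical risk.\<close>

theorem holder_generalization_gap:
  fixes f :: "'w \<Rightarrow> 'z \<Rightarrow> real"
  assumes f_meas: "(\<lambda>(w, z). f w z) \<in> borel_measurable (borel \<Otimes>\<^sub>M \<rho>)"
    and nonneg: "\<And>w z. z \<in> space \<rho> \<Longrightarrow> 0 \<le> f w z"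
    and F_int: "\<And>w. integrable \<rho> (f w)"
    and int_F: "integrable \<Omega> (\<lambda>\<omega>. pop_risk \<rho> f (avg \<omega>))"
    and int_FS: "integrable \<Omega> (\<lambda>\<omega>. emp_risk n f (fst \<omega>) (avg \<omega>))"
    and int_FS_t: "\<And>t. t \<in> {1..T} \<Longrightarrow> integrable \<Omega> (\<lambda>\<omega>. emp_risk n f (fst \<omega>) (iter \<omega> t))"
    and sub: "is_subgradient f g (space \<rho>)"
    and holder: "holder_smooth \<alpha> L g (space \<rho>)"
    and \<alpha>: "0 \<le> \<alpha>" "\<alpha> < 1" and M: "\<alpha> = 0 \<Longrightarrow> 0 \<le> M"
    and \<eta>: "\<And>t. t \<in> {1..T} \<Longrightarrow> 0 < \<eta> t" and \<gamma>: "\<gamma> > 0"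
  defines "q \<equiv> 2 * \<alpha> / (1 + \<alpha>)"
  shows "(\<integral>\<omega>. pop_risk \<rho> f (avg \<omega>) - emp_risk n f (fst \<omega>) (avg \<omega>) \<partial>\<Omega>)
    \<le> (c_a1 \<alpha> L M)\<^sup>2 / (2 * \<gamma>) * (\<integral>\<omega>. nnpow (pop_risk \<rho> f (avg \<omega>)) q \<partial>\<Omega>)
      + \<gamma> / 2 * ((c_a3 \<alpha> L)\<^sup>2 * exp 1 * (\<Sum>t=1..T. \<eta> t powr (2 / (1 - \<alpha>)))
        + 4 * exp 1 * (c_a1 \<alpha> L M)\<^sup>2 * (1 + real T / real n) / real n
          * (\<Sum>t=1..T. (\<eta> t)\<^sup>2 * (\<integral>\<omega>. nnpow (emp_risk n f (fst \<omega>) (iter \<omega> t)) q \<partial>\<Omega>)))"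
proof -
  have q: "0 \<le> q" "q \<le> 1" using \<alpha> by (auto simp: q_def field_simps)
  have sub': "f w z + inner (g w z) (w' - w) \<le> f w' z" if "z \<in> space \<rho>" for z w w'
    using sub that by (auto simp: is_subgradient_def)
  have holder': "norm (g w z - g w' z) \<le> L * nnpow (norm (w - w')) \<alpha>" if "z \<in> space \<rho>" for z w w'
    using holder that by (auto simp: holder_smooth_def)
  \<comment> \<open>The Hoelder bound between 0 and a unit vector forces \<open>L\<close> to be
    nonnegative, whatever the exponent.\<close>
  have L: "L \<ge> 0"
  proof -
    obtain z where z: "z \<in> space \<rho>" using rho.not_empty by blast
    obtain b :: 'w where "b \<in> Basis" using nonempty_Basis by blast
    then have "norm (g b z - g 0 z) \<le> L" using holder'[OF z, of b 0] by (simp add: nnpow_def split: if_splits)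
    then show ?thesis by (rule order_trans[OF norm_ge_zero])
  qed
  define c1 where "c1 = (c_a1 \<alpha> L M)\<^sup>2"
  define U where "U w z = nnpow (f w z) q" for w z
  define a where "a t = (c_a3 \<alpha> L)\<^sup>2 * \<eta> t powr (2 / (1 - \<alpha>))" for t
  have U_meas: "(\<lambda>(w, z). U w z) \<in> borel_measurable (borel \<Otimes>\<^sub>M \<rho>)"
    using borel_measurable_nnpow[OF f_meas, of q] by (simp add: U_def split_beta')
  have U_nonneg: "0 \<le> U w z" for w z by (simp add: U_def)
  have c1: "c1 \<ge> 0" and a: "a t \<ge> 0" for t by (simp_all add: c1_def a_def)
  have self: "(norm (g w z))\<^sup>2 \<le> c1 * U w z" if "z \<in> space \<rho>" for w z
    unfolding c1_def U_def q_def
    by (rule holder_self_bounding[of "\<lambda>w. f w z" "\<lambda>w. g w z", OF sub'[OF that] holder'[OF that] nonneg[OF that] L \<alpha>(1) M])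
  have step: "(norm ((w - \<eta> t *\<^sub>R g w z) - (w' - \<eta> t *\<^sub>R g w' z)))\<^sup>2 \<le> (norm (w - w'))\<^sup>2 + a t"
    if "t \<in> {1..T}" "z \<in> space \<rho>" for t z w w'
    unfolding a_def
    by (rule holder_gradient_step[of "\<lambda>w. f w z" "\<lambda>w. g w z", OF sub'[OF that(2)] holder'[OF that(2)] L \<alpha> \<eta>[OF that(1)]])
  have int_t: "integrable \<Omega> (\<lambda>\<omega>. U (iter \<omega> t) (fst \<omega> i))" if "t \<in> {1..T}" "i < n" for t i
    unfolding U_def
  proof (rule integrable_nnpow[OF _ _ _ q])
    show "finite_measure \<Omega>" by (rule Om.finite_measure_axioms)
    show "integrable \<Omega> (\<lambda>\<omega>. f (iter \<omega> t) (fst \<omega> i))"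
      using that by (intro integrable_sample_loss f_meas nonneg int_FS_t measurable_iter) auto
    show "AE \<omega> in \<Omega>. 0 \<le> f (iter \<omega> t) (fst \<omega> i)"
      using that by (intro AE_I2 nonneg sample_in_space)
  qed
  note stab = avg_stability[of U c1 a, OF U_meas U_nonneg c1 a step self int_t]
  note swapped_int = integrable_swapped_nnpow[OF f_meas _ F_int int_F _ q]
  note swapped_le = integral_swapped_nnpow_le[OF f_meas _ F_int int_F _ q]
  have "(\<integral>\<omega>. pop_risk \<rho> f (avg \<omega>) - emp_risk n f (fst \<omega>) (avg \<omega>) \<partial>\<Omega>)
    \<le> (\<Sum>i<n. \<integral>x. c1 / (2 * \<gamma>) * U (avg (fst (swap i x))) (fst (fst x) i) \<partial>(\<Omega> \<Otimes>\<^sub>M \<rho>)) / real n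
      + \<gamma> / 2 * ((\<Sum>i<n. exp 1 * (\<Sum>t=1..T. increment U c1 a i t)) / real n)"
  proof (rule generalization_gap_le[OF f_meas _ F_int int_F int_FS _ _ stab])
    fix i x assume i: "i < n" and x: "x \<in> space (\<Omega> \<Otimes>\<^sub>M \<rho>)"
    define s w w' where "s = fst (fst x) i" and "w = avg (fst x)" and "w' = avg (fst (swap i x))"
    have s: "s \<in> space \<rho>" using x i by (auto simp: s_def space_pair_measure intro!: sample_in_space)
    have "f w' s - f w s \<le> inner (g w' s) (w' - w)"
      using sub'[OF s, of w' w] by (simp add: inner_diff_right)
    also have "\<dots> \<le> (norm (g w' s))\<^sup>2 / (2 * \<gamma>) + \<gamma> / 2 * (norm (w' - w))\<^sup>2"
      using \<gamma> by (rule inner_le_young)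
    also have "(norm (g w' s))\<^sup>2 / (2 * \<gamma>) \<le> (c1 * U w' s) / (2 * \<gamma>)"
      using self[OF s] \<gamma> by (intro divide_right_mono) auto
    finally show "f (avg (fst (swap i x))) (fst (fst x) i) - f (avg (fst x)) (fst (fst x) i)
        \<le> c1 / (2 * \<gamma>) * U (avg (fst (swap i x))) (fst (fst x) i)
          + \<gamma> / 2 * (norm (avg (fst (swap i x)) - avg (fst x)))\<^sup>2"
      by (simp add: s_def w_def w'_def)
  next
    show "integrable (\<Omega> \<Otimes>\<^sub>M \<rho>) (\<lambda>x. c1 / (2 * \<gamma>) * U (avg (fst (swap i x))) (fst (fst x) i))" if "i < n" for i
      unfolding U_def using swapped_int[OF nonneg that] by simp
  qed (use \<gamma> nonneg in auto)
  also have "\<dots> \<le> c1 / (2 * \<gamma>) * (\<integral>\<omega>. nnpow (pop_risk \<rho> f (avg \<omega>)) q \<partial>\<Omega>)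
      + \<gamma> / 2 * (exp 1 * ((\<Sum>t=1..T. a t) + 4 * (1 + real T / real n) * c1 / real n *
          (\<Sum>t=1..T. (\<eta> t)\<^sup>2 * (\<integral>\<omega>. nnpow (emp_risk n f (fst \<omega>) (iter \<omega> t)) q \<partial>\<Omega>))))"
  proof (rule add_mono)
    let ?R = "\<integral>\<omega>. nnpow (pop_risk \<rho> f (avg \<omega>)) q \<partial>\<Omega>"
    have "(\<integral>x. c1 / (2 * \<gamma>) * U (avg (fst (swap i x))) (fst (fst x) i) \<partial>(\<Omega> \<Otimes>\<^sub>M \<rho>)) \<le> c1 / (2 * \<gamma>) * ?R"
      if "i < n" for i
      unfolding U_def using mult_left_mono[OF swapped_le[OF nonneg that], of "c1 / (2 * \<gamma>)"] c1 \<gamma> by simp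
    then have "(\<Sum>i<n. \<integral>x. c1 / (2 * \<gamma>) * U (avg (fst (swap i x))) (fst (fst x) i) \<partial>(\<Omega> \<Otimes>\<^sub>M \<rho>)) / real n
        \<le> (\<Sum>i<n. c1 / (2 * \<gamma>) * ?R) / real n"
      by (intro divide_right_mono sum_mono) auto
    then show "(\<Sum>i<n. \<integral>x. c1 / (2 * \<gamma>) * U (avg (fst (swap i x))) (fst (fst x) i) \<partial>(\<Omega> \<Otimes>\<^sub>M \<rho>)) / real n
        \<le> c1 / (2 * \<gamma>) * ?R"
      using n by simp
    have mean: "(\<Sum>i<n. \<integral>\<omega>. U (iter \<omega> t) (fst \<omega> i) \<partial>\<Omega>) / real n
        \<le> (\<integral>\<omega>. nnpow (emp_risk n f (fst \<omega>) (iter \<omega> t)) q \<partial>\<Omega>)" if "t \<in> {1..T}" for t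
      unfolding U_def
      using int_t[OF that] int_FS_t[OF that] by (intro mean_sample_nnpow_le nonneg q) (simp_all add: U_def)
    have total: "(\<Sum>i<n. exp 1 * (\<Sum>t=1..T. increment U c1 a i t)) / real n
      = exp 1 * ((\<Sum>t=1..T. a t) + 4 * (1 + real T / real n) * c1 / real n *
        (\<Sum>t=1..T. (\<eta> t)\<^sup>2 * ((\<Sum>i<n. \<integral>\<omega>. U (iter \<omega> t) (fst \<omega> i) \<partial>\<Omega>) / real n)))"
      by (rule mean_increment[OF U_meas]) ((rule U_nonneg c1 a step self int_t; assumption)+)
    show "\<gamma> / 2 * ((\<Sum>i<n. exp 1 * (\<Sum>t=1..T. increment U c1 a i t)) / real n)
        \<le> \<gamma> / 2 * (exp 1 * ((\<Sum>t=1..T. a t) + 4 * (1 + real T / real n) * c1 / real n *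
          (\<Sum>t=1..T. (\<eta> t)\<^sup>2 * (\<integral>\<omega>. nnpow (emp_risk n f (fst \<omega>) (iter \<omega> t)) q \<partial>\<Omega>))))"
      unfolding total
      using \<gamma> c1 by (intro mult_left_mono add_left_mono sum_mono mean) simp_all
  qed
  also have "\<dots> = c1 / (2 * \<gamma>) * (\<integral>\<omega>. nnpow (pop_risk \<rho> f (avg \<omega>)) q \<partial>\<Omega>)
      + \<gamma> / 2 * ((c_a3 \<alpha> L)\<^sup>2 * exp 1 * (\<Sum>t=1..T. \<eta> t powr (2 / (1 - \<alpha>)))
        + 4 * exp 1 * c1 * (1 + real T / real n) / real n
          * (\<Sum>t=1..T. (\<eta> t)\<^sup>2 * (\<integral>\<omega>. nnpow (emp_risk n f (fst \<omega>) (iter \<omega> t)) q \<partial>\<Omega>)))"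
  proof -
    have "R + \<gamma> / 2 * (e * (C * A + 4 * r * c1 / N * Q)) = R + \<gamma> / 2 * (C * e * A + 4 * e * c1 * r / N * Q)"
      for R e C A r N Q :: real
      by (simp add: algebra_simps)
    then show ?thesis unfolding a_def sum_distrib_left[symmetric] .
  qed
  finally show ?thesis unfolding c1_def .
qed

end

section \<open>The generalization bounds for differentially private SGD\<close>

theorem theorem7:
  fixes X :: "(real^'d) set" and Y :: "real set"
    and \<rho> :: "((real^'d) \<times> real) measure"
    and f :: "real^'d \<Rightarrow> (real^'d) \<times> real \<Rightarrow> real"
    and g :: "real^'d \<Rightarrow> (real^'d) \<times> real \<Rightarrow> real^'d"
    and n T :: nat and \<eta> :: "nat \<Rightarrow> real"
    and G \<epsilon> \<delta> \<beta> \<gamma> L \<alpha> :: real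
  assumes rho: "prob_space \<rho>" "space \<rho> = X \<times> Y" "sets \<rho> = sets (restrict_space borel (X \<times> Y))"
    and n: "n \<ge> 1" and T: "T \<ge> 1"
    and params: "G > 0" "\<epsilon> > 0" "0 < \<delta>" "\<delta> < 1" "0 < \<beta>" "\<beta> < 1"
    and eta_pos: "\<And>t. t \<in> {1..T} \<Longrightarrow> \<eta> t > 0"
    and gamma: "\<gamma> > 0"
    and f_meas: "(\<lambda>(w, z). f w z) \<in> borel_measurable (borel \<Otimes>\<^sub>M \<rho>)"
    and g_meas: "(\<lambda>(w, z). g w z) \<in> borel_measurable (borel \<Otimes>\<^sub>M \<rho>)"
    and f_nonneg: "\<And>w z. z \<in> X \<times> Y \<Longrightarrow> f w z \<ge> 0"
    and f_convex: "\<And>z. z \<in> X \<times> Y \<Longrightarrow> convex_on UNIV (\<lambda>w. f w z)"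
    and g_subgrad: "is_subgradient f g (X \<times> Y)"
    and F_int: "\<And>w. integrable \<rho> (f w)"
    and int_F_priv: "integrable (alg_space \<rho> n T (dp_sigma2 G \<epsilon> \<delta> \<beta> T n))
                       (\<lambda>\<omega>. pop_risk \<rho> f (w_priv g \<eta> T \<omega>))"
    and int_FS_priv: "integrable (alg_space \<rho> n T (dp_sigma2 G \<epsilon> \<delta> \<beta> T n))
                       (\<lambda>\<omega>. emp_risk n f (fst \<omega>) (w_priv g \<eta> T \<omega>))"
    and int_FS_t: "\<And>t. t \<in> {1..T} \<Longrightarrow> integrable (alg_space \<rho> n T (dp_sigma2 G \<epsilon> \<delta> \<beta> T n))
                       (\<lambda>\<omega>. emp_risk n f (fst \<omega>) (iterate_w g \<eta> \<omega> t))"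
  shows
   "(l_smooth L f g (X \<times> Y) \<and> (\<forall>t\<in>{1..T}. \<eta> t \<le> 2 / L) \<longrightarrow>
      (\<integral>\<omega>. pop_risk \<rho> f (w_priv g \<eta> T \<omega>) - emp_risk n f (fst \<omega>) (w_priv g \<eta> T \<omega>)
          \<partial>alg_space \<rho> n T (dp_sigma2 G \<epsilon> \<delta> \<beta> T n))
      \<le> L / \<gamma> * (\<integral>\<omega>. emp_risk n f (fst \<omega>) (w_priv g \<eta> T \<omega>)
                    \<partial>alg_space \<rho> n T (dp_sigma2 G \<epsilon> \<delta> \<beta> T n))
        + 4 * exp 1 * (L + \<gamma>) * (1 + real T / real n) * L / real n
          * (\<Sum>t=1..T. (\<eta> t)\<^sup>2 * (\<integral>\<omega>. emp_risk n f (fst \<omega>) (iterate_w g \<eta> \<omega> t)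
                    \<partial>alg_space \<rho> n T (dp_sigma2 G \<epsilon> \<delta> \<beta> T n))))
    \<and>
    (holder_smooth \<alpha> L g (X \<times> Y) \<and> 0 \<le> \<alpha> \<and> \<alpha> < 1
       \<and> (\<alpha> = 0 \<longrightarrow> bdd_above (f 0 ` (X \<times> Y))) \<longrightarrow>
      (\<integral>\<omega>. pop_risk \<rho> f (w_priv g \<eta> T \<omega>) - emp_risk n f (fst \<omega>) (w_priv g \<eta> T \<omega>)
          \<partial>alg_space \<rho> n T (dp_sigma2 G \<epsilon> \<delta> \<beta> T n))
      \<le> (c_a1 \<alpha> L (Sup (f 0 ` (X \<times> Y))))\<^sup>2 / (2 * \<gamma>)
          * (\<integral>\<omega>. nnpow (pop_risk \<rho> f (w_priv g \<eta> T \<omega>)) (2 * \<alpha> / (1 + \<alpha>))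
                    \<partial>alg_space \<rho> n T (dp_sigma2 G \<epsilon> \<delta> \<beta> T n))
        + \<gamma> / 2 * ((c_a3 \<alpha> L)\<^sup>2 * exp 1 * (\<Sum>t=1..T. (\<eta> t) powr (2 / (1 - \<alpha>)))
            + 4 * exp 1 * (c_a1 \<alpha> L (Sup (f 0 ` (X \<times> Y))))\<^sup>2 * (1 + real T / real n) / real n
              * (\<Sum>t=1..T. (\<eta> t)\<^sup>2 *
                   (\<integral>\<omega>. nnpow (emp_risk n f (fst \<omega>) (iterate_w g \<eta> \<omega> t)) (2 * \<alpha> / (1 + \<alpha>))
                      \<partial>alg_space \<rho> n T (dp_sigma2 G \<epsilon> \<delta> \<beta> T n)))))"
proof -
  let ?s2 = "dp_sigma2 G \<epsilon> \<delta> \<beta> T n"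
  have s2: "?s2 > 0"
    using params n T by (intro dp_sigma2_pos)
  interpret noisy_sgd \<rho> "gauss_vec ?s2 :: (real^'d) measure" n T g \<eta>
    using rho(1) prob_space_gauss_vec[OF s2] sets_gauss_vec n T g_meas by (rule noisy_sgd.intro)
  have alg: "alg_space \<rho> n T ?s2 = \<Omega>"
    by (simp add: alg_space_def \<Omega>_def samples_def indices_def noises_def)
  have nonneg: "0 \<le> f w z" if "z \<in> space \<rho>" for w z
    using f_nonneg that rho(2) by simp
  have F_avg: "(\<lambda>\<omega>. pop_risk \<rho> f (avg \<omega>)) \<in> borel_measurable \<Omega>"
    using measurable_pop_risk[OF f_meas] by measurable
  have FS_avg: "(\<lambda>\<omega>. emp_risk n f (fst \<omega>) (avg \<omega>)) \<in> borel_measurable \<Omega>"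
    by (rule measurable_emp_risk[OF f_meas measurable_avg])
  have FS_iter: "(\<lambda>\<omega>. emp_risk n f (fst \<omega>) (iter \<omega> t)) \<in> borel_measurable \<Omega>" if "t \<in> {1..T}" for t
    using that by (intro measurable_emp_risk[OF f_meas] measurable_iter) simp
  note int_F = int_F_priv[unfolded alg] and int_FS = int_FS_priv[unfolded alg]
    and int_t = int_FS_t[unfolded alg]
  \<comment> \<open>Measurability of the original integrands comes from their assumed integrability:
    at indices outside \<open>{..<n}\<close> the iterates of \<open>iterate_w\<close> read the
    sample at \<open>undefined\<close>, where nothing is known about \<open>g\<close>.\<close>
  note meas_F = borel_measurable_integrable[OF int_F] and meas_FS = borel_measurable_integrable[OF int_FS]
    and meas_t = borel_measurable_integrable[OF int_t]
  have AE_F: "AE \<omega> in \<Omega>. pop_risk \<rho> f (w_priv g \<eta> T \<omega>) = pop_risk \<rho> f (avg \<omega>)"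
    and AE_FS: "AE \<omega> in \<Omega>. emp_risk n f (fst \<omega>) (w_priv g \<eta> T \<omega>) = emp_risk n f (fst \<omega>) (avg \<omega>)"
    using AE_iterate_w by (eventually_elim, simp)+
  have AE_t: "AE \<omega> in \<Omega>. emp_risk n f (fst \<omega>) (iterate_w g \<eta> \<omega> t) = emp_risk n f (fst \<omega>) (iter \<omega> t)"
    if "t \<in> {1..T}" for t
    using AE_iterate_w by eventually_elim (use that in simp)
  have int_F': "integrable \<Omega> (\<lambda>\<omega>. pop_risk \<rho> f (avg \<omega>))"
    using integrable_cong_AE[OF meas_F F_avg AE_F] int_F by simp
  have int_FS': "integrable \<Omega> (\<lambda>\<omega>. emp_risk n f (fst \<omega>) (avg \<omega>))"
    using integrable_cong_AE[OF meas_FS FS_avg AE_FS] int_FS by simp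
  have int_t': "integrable \<Omega> (\<lambda>\<omega>. emp_risk n f (fst \<omega>) (iter \<omega> t))" if "t \<in> {1..T}" for t
    using integrable_cong_AE[OF meas_t[OF that] FS_iter[OF that] AE_t[OF that]] int_t[OF that] by simp
  have gap_eq: "(\<integral>\<omega>. pop_risk \<rho> f (w_priv g \<eta> T \<omega>) - emp_risk n f (fst \<omega>) (w_priv g \<eta> T \<omega>) \<partial>\<Omega>)
      = (\<integral>\<omega>. pop_risk \<rho> f (avg \<omega>) - emp_risk n f (fst \<omega>) (avg \<omega>) \<partial>\<Omega>)"
  proof (intro integral_cong_AE borel_measurable_diff meas_F meas_FS F_avg FS_avg)
    show "AE \<omega> in \<Omega>. pop_risk \<rho> f (w_priv g \<eta> T \<omega>) - emp_risk n f (fst \<omega>) (w_priv g \<eta> T \<omega>)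
        = pop_risk \<rho> f (avg \<omega>) - emp_risk n f (fst \<omega>) (avg \<omega>)"
      using AE_F AE_FS by eventually_elim simp
  qed
  have FS_eq: "(\<integral>\<omega>. emp_risk n f (fst \<omega>) (w_priv g \<eta> T \<omega>) \<partial>\<Omega>) = (\<integral>\<omega>. emp_risk n f (fst \<omega>) (avg \<omega>) \<partial>\<Omega>)"
    by (rule integral_cong_AE[OF meas_FS FS_avg AE_FS])
  have t_eq: "(\<integral>\<omega>. emp_risk n f (fst \<omega>) (iterate_w g \<eta> \<omega> t) \<partial>\<Omega>) = (\<integral>\<omega>. emp_risk n f (fst \<omega>) (iter \<omega> t) \<partial>\<Omega>)"
    if "t \<in> {1..T}" for t
    by (rule integral_cong_AE[OF meas_t[OF that] FS_iter[OF that] AE_t[OF that]])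
  have F_pow_eq: "(\<integral>\<omega>. nnpow (pop_risk \<rho> f (w_priv g \<eta> T \<omega>)) p \<partial>\<Omega>) = (\<integral>\<omega>. nnpow (pop_risk \<rho> f (avg \<omega>)) p \<partial>\<Omega>)" for p
    using AE_F by (intro integral_cong_AE borel_measurable_nnpow meas_F F_avg) auto
  have t_pow_eq: "(\<integral>\<omega>. nnpow (emp_risk n f (fst \<omega>) (iterate_w g \<eta> \<omega> t)) p \<partial>\<Omega>)
      = (\<integral>\<omega>. nnpow (emp_risk n f (fst \<omega>) (iter \<omega> t)) p \<partial>\<Omega>)" if "t \<in> {1..T}" for t p
    using AE_t[OF that] by (intro integral_cong_AE borel_measurable_nnpow meas_t[OF that] FS_iter[OF that]) auto
  show ?thesis
    unfolding alg gap_eq FS_eq F_pow_eq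
  proof (intro conjI impI)
    assume "l_smooth L f g (X \<times> Y) \<and> (\<forall>t\<in>{1..T}. \<eta> t \<le> 2 / L)"
    then show "(\<integral>\<omega>. pop_risk \<rho> f (avg \<omega>) - emp_risk n f (fst \<omega>) (avg \<omega>) \<partial>\<Omega>)
      \<le> L / \<gamma> * (\<integral>\<omega>. emp_risk n f (fst \<omega>) (avg \<omega>) \<partial>\<Omega>)
        + 4 * exp 1 * (L + \<gamma>) * (1 + real T / real n) * L / real n
          * (\<Sum>t=1..T. (\<eta> t)\<^sup>2 * (\<integral>\<omega>. emp_risk n f (fst \<omega>) (iterate_w g \<eta> \<omega> t) \<partial>\<Omega>))"
      using smooth_generalization_gap[OF f_meas nonneg F_int int_F' int_FS' int_t' _ _ eta_pos _ gamma]
        g_subgrad rho(2) by (simp add: t_eq)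
  next
    assume h: "holder_smooth \<alpha> L g (X \<times> Y) \<and> 0 \<le> \<alpha> \<and> \<alpha> < 1 \<and> (\<alpha> = 0 \<longrightarrow> bdd_above (f 0 ` (X \<times> Y)))"
    \<comment> \<open>Boundedness makes \<open>Sup\<close> a genuine upper bound of the values
      \<open>f 0 z\<close>; one such value exists because a probability space is nonempty.\<close>
    have M: "0 \<le> Sup (f 0 ` (X \<times> Y))" if "\<alpha> = 0"
    proof -
      obtain z where z: "z \<in> X \<times> Y" using rho.not_empty rho(2) by auto
      have "0 \<le> f 0 z" using z by (rule f_nonneg)
      also have "f 0 z \<le> Sup (f 0 ` (X \<times> Y))" using z h that by (intro cSup_upper) auto
      finally show ?thesis .
    qed
    show "(\<integral>\<omega>. pop_risk \<rho> f (avg \<omega>) - emp_risk n f (fst \<omega>) (avg \<omega>) \<partial>\<Omega>)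
      \<le> (c_a1 \<alpha> L (Sup (f 0 ` (X \<times> Y))))\<^sup>2 / (2 * \<gamma>)
          * (\<integral>\<omega>. nnpow (pop_risk \<rho> f (avg \<omega>)) (2 * \<alpha> / (1 + \<alpha>)) \<partial>\<Omega>)
        + \<gamma> / 2 * ((c_a3 \<alpha> L)\<^sup>2 * exp 1 * (\<Sum>t=1..T. (\<eta> t) powr (2 / (1 - \<alpha>)))
            + 4 * exp 1 * (c_a1 \<alpha> L (Sup (f 0 ` (X \<times> Y))))\<^sup>2 * (1 + real T / real n) / real n
              * (\<Sum>t=1..T. (\<eta> t)\<^sup>2 *
                   (\<integral>\<omega>. nnpow (emp_risk n f (fst \<omega>) (iterate_w g \<eta> \<omega> t)) (2 * \<alpha> / (1 + \<alpha>)) \<partial>\<Omega>)))"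
      using holder_generalization_gap[OF f_meas nonneg F_int int_F' int_FS' int_t' _ _ _ _ M eta_pos gamma]
        g_subgrad rho(2) h by (simp add: t_pow_eq)
  qed
qed

end
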